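(* Let $q$ be a prime power and let $n,d,j$ be integers with $n\ge 2d$ and $1 \le j \le d$. (i) If $q \geq 3$, or $q=2$ and $n \ge 2d+1$, then the smallest eigenvalue of $G_q(n,d,j)$ is $G_j(d-j+1)$. (ii) If $(n, q) = (2d, 2)$ and $7 \le j \le d-5$, then the smallest eigenvalue of $G_q(n,d,j)$ is $G_j(d-j)$.
   Context: $G_q(n,d,j)$ is the graph whose vertices are the $d$-dimensional subspaces of an $n$-dimensional vector space over $\mathbb{F}_q$, two vertices being adjacent when their intersection has dimension $d-j$ (the distance-$j$ graph of the Grassmann graph). With Gaussian coefficients $\genfrac{[}{]}{0pt}{}{a}{m} = \prod_{h=0}^{m-1}\frac{q^{a-h}-1}{q^{m-h}-1}$ (and $0$ if $m<0$), its eigenvalues are the numbers $G_j(i)$, $0\le i\le d$, where $$G_j(i) = \sum_{h=0}^j (-1)^{j-h} \, q^{hi + \binom{j-h}{2}} \genfrac{[}{]}{0pt}{}{d-i}{h} \genfrac{[}{]}{0pt}{}{d-h}{j-h} \genfrac{[}{]}{0pt}{}{n-d-i+h}{h}.$$ *)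

theory Defs
  imports
    "HOL-Number_Theory.Prime_Powers"
    "HOL-Library.Cardinality"
    "Jordan_Normal_Form.Char_Poly"
begin

text \<open>The Gaussian coefficient. It is evaluated with integer entries, so that no subtraction is
  truncated.\<close>

definition gauss_coeff :: "nat \<Rightarrow> int \<Rightarrow> int \<Rightarrow> real" where
  "gauss_coeff q a m =
     (if m < 0 then 0
      else \<Prod>h = 0..<nat m. (real q powi (a - int h) - 1) / (real q powi (m - int h) - 1))"

definition grassmann_G :: "nat \<Rightarrow> nat \<Rightarrow> nat \<Rightarrow> nat \<Rightarrow> nat \<Rightarrow> real" where
  "grassmann_G q n d j i =
     (\<Sum>h = 0..j. (-1) ^ (j - h) * real q ^ (h * i + (j - h choose 2))
        * gauss_coeff q (int d - int i) (int h)
        * gauss_coeff q (int d - int h) (int j - int h)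
        * gauss_coeff q (int n - int d - int i + int h) (int h))"

text \<open>Intended for a finite-dimensional ambient space: the library dimension of an
  infinite-dimensional space is 0.\<close>

definition grassmann_vertices ::
  "('k::field \<Rightarrow> 'v::ab_group_add \<Rightarrow> 'v) \<Rightarrow> nat \<Rightarrow> 'v set set" where
  "grassmann_vertices scale d =
     {U. module.subspace scale U \<and> vector_space.dim scale U = d}"

definition grassmann_adj ::
  "('k::field \<Rightarrow> 'v::ab_group_add \<Rightarrow> 'v) \<Rightarrow> nat \<Rightarrow> nat \<Rightarrow> 'v set \<Rightarrow> 'v set \<Rightarrow> bool" where
  "grassmann_adj scale d j U W \<longleftrightarrow> int (vector_space.dim scale (U \<inter> W)) = int d - int j"

definition adjacency_matrix :: "('a \<Rightarrow> 'a \<Rightarrow> bool) \<Rightarrow> 'a list \<Rightarrow> real mat" where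
  "adjacency_matrix E vs =
     mat (length vs) (length vs) (\<lambda>(r, s). if E (vs ! r) (vs ! s) then 1 else 0)"

text \<open>Matrices are indexed by natural numbers, so the vertices have to be listed in some order;
  different listings give permutation-similar adjacency matrices. Adjacency is symmetric in the
  intended use, so the real eigenvalues are all the eigenvalues.\<close>

definition graph_eigenvalue :: "'a set \<Rightarrow> ('a \<Rightarrow> 'a \<Rightarrow> bool) \<Rightarrow> real \<Rightarrow> bool" where
  "graph_eigenvalue V E ev \<longleftrightarrow>
     (\<exists>vs. distinct vs \<and> set vs = V \<and> eigenvalue (adjacency_matrix E vs) ev)"

definition smallest_graph_eigenvalue :: "'a set \<Rightarrow> ('a \<Rightarrow> 'a \<Rightarrow> bool) \<Rightarrow> real \<Rightarrow> bool" where
  "smallest_graph_eigenvalue V E ev \<longleftrightarrow>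
     graph_eigenvalue V E ev \<and> (\<forall>ev'. graph_eigenvalue V E ev' \<longrightarrow> ev \<le> ev')"

end

theory Submission
  imports Defs
begin

text \<open>
  Write \<open>[a]\<close> for the \<open>q\<close>-integer. On functions on the lattice of subspaces, let \<open>up\<close> and \<open>down\<close> sum over the
  lower and the upper covers. Then \<open>down up - up down\<close> acts on dimension \<open>k\<close> as \<open>[n - k] - [k]\<close>, so if
  \<open>g\<close> lives on dimension \<open>i\<close> and \<open>down g = 0\<close>, then \<open>up\<^sup>d\<^sup>-\<^sup>i g\<close> is an eigenvector of every
  \<open>up\<^sup>h down\<^sup>h\<close> on dimension \<open>d\<close>; by \<open>q\<close>-inversion the adjacency matrix is a combination of these, with eigenvalue
  \<open>G\<^sub>j(i)\<close>. Conversely, for an eigenvector \<open>f\<close> take the last nonzero \<open>g = down\<^sup>h f\<close>: since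
  \<open>up\<^sup>h g\<close> pairs with \<open>f\<close> to the squared norm of \<open>g\<close>, the eigenvalue of \<open>f\<close> is \<open>G\<^sub>j(d - h)\<close>.

  For the comparison, a Pascal recursion in \<open>i\<close> turns \<open>G\<^sub>j(i)\<close> into an alternating sum over \<open>t\<close> whose
  terms increase up to the last nonzero one, at \<open>t = min j (d - i)\<close>. Hence \<open>G\<^sub>j(i)\<close> is nonnegative for
  \<open>i \<le> d - j\<close>, and for \<open>i = d - j + s\<close> with \<open>s \<ge> 1\<close> has the sign of \<open>(-1)\<^sup>s\<close> and an absolute value between
  a third of the dominant term and that term, while the dominant terms at \<open>s \<ge> 3\<close> are at most a third of the one at \<open>s = 1\<close>.
  The monotonicity fails only for \<open>q = 2\<close>, \<open>n = 2 d\<close>, \<open>i = d - j\<close>: there the second largest term is almost twice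
  the largest one, so \<open>G\<^sub>j(d - j)\<close> is very negative.
\<close>

section \<open>Gaussian coefficients\<close>

text \<open>Gaussian coefficient by the \<open>q\<close>-Pascal rule, over a real base: vanishing
  for \<open>k > n\<close> and nonnegativity become plain inductions, and the later comparisons can
  be made for every real \<open>q\<close> from 2 on.\<close>

fun qbinom :: "real \<Rightarrow> nat \<Rightarrow> nat \<Rightarrow> real" where
  "qbinom q n 0 = 1"
| "qbinom q 0 (Suc k) = 0"
| "qbinom q (Suc n) (Suc k) = qbinom q n k + q ^ Suc k * qbinom q n (Suc k)"

definition qfact :: "real \<Rightarrow> nat \<Rightarrow> real" where
  "qfact q n = (\<Prod>h<n. q ^ Suc h - 1)"

lemma qfact_0 [simp]: "qfact q 0 = 1"
  by (simp add: qfact_def)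

lemma qfact_Suc: "qfact q (Suc n) = (q ^ Suc n - 1) * qfact q n"
  by (simp add: qfact_def)

lemma power_Suc_gt1: "q > 1 \<Longrightarrow> q ^ Suc k > (1::real)"
  by (rule one_less_power) auto

lemma qfact_pos: "q > 1 \<Longrightarrow> qfact q n > 0"
  unfolding qfact_def by (intro prod_pos) (simp add: power_Suc_gt1 del: power_Suc)

lemma qbinom_eq_0: "n < k \<Longrightarrow> qbinom q n k = 0"
  by (induction q n k rule: qbinom.induct) auto

lemma qbinom_nonneg: "q \<ge> 0 \<Longrightarrow> qbinom q n k \<ge> 0"
  by (induction q n k rule: qbinom.induct) auto

lemma qbinom_self [simp]: "qbinom q n n = 1"
  by (induction n) (auto simp: qbinom_eq_0)

text \<open>Division-free quotient formula. With \<open>n = Suc k + m\<close>, the two summands of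
  the Pascal rule combine because \<open>(q ^ Suc k - 1) + q ^ Suc k * (q ^ Suc m - 1) = q ^ Suc n -
  1\<close>.\<close>

lemma qbinom_qfact: "k \<le> n \<Longrightarrow> qbinom q n k * (qfact q k * qfact q (n - k)) = qfact q n"
proof (induction q n k rule: qbinom.induct)
  case (3 q n k)
  show ?case
  proof (cases "k = n")
    case True
    then show ?thesis by (simp add: qbinom_eq_0)
  next
    case False
    with 3 have "Suc k \<le> n" by simp
    then obtain m where n: "n = Suc k + m" by (metis le_Suc_ex)
    have 1: "qbinom q n k * (qfact q k * qfact q (Suc m)) = qfact q n"
      using 3 n by simp
    have 2: "qbinom q n (Suc k) * (qfact q (Suc k) * qfact q m) = qfact q n"
      using 3 n by simp
    have "qbinom q (Suc n) (Suc k) * (qfact q (Suc k) * qfact q (Suc m))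
      = (q ^ Suc k - 1) * (qbinom q n k * (qfact q k * qfact q (Suc m)))
       + q ^ Suc k * (q ^ Suc m - 1) * (qbinom q n (Suc k) * (qfact q (Suc k) * qfact q m))"
      by (simp add: qfact_Suc algebra_simps)
    also have "\<dots> = (q ^ Suc n - 1) * qfact q n"
      unfolding 1 2 by (simp add: n algebra_simps power_add)
    finally show ?thesis by (simp add: qfact_Suc n)
  qed
qed auto

lemma qbinom_eq: "q > 1 \<Longrightarrow> k \<le> n \<Longrightarrow> qbinom q n k = qfact q n / (qfact q k * qfact q (n - k))"
  using qbinom_qfact[of k n q] qfact_pos[of q k] qfact_pos[of q "n - k"] by (simp add: field_simps)

lemma qbinom_symmetric: "q > 1 \<Longrightarrow> k \<le> n \<Longrightarrow> qbinom q n (n - k) = qbinom q n k"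
  by (simp add: qbinom_eq mult.commute)

text \<open>The truncated exponent is harmless: for \<open>k = n\<close> the factor
  \<open>q ^ 0 - 1\<close> is zero, and for \<open>k > n\<close> both coefficients vanish. No range
  condition is therefore carried along.\<close>

lemma qbinom_Suc_right:
  assumes "q > 1"
  shows "(q ^ Suc k - 1) * qbinom q n (Suc k) = (q ^ (n - k) - 1) * qbinom q n k"
proof (cases "Suc k \<le> n")
  case True
  then obtain m where n: "n = Suc k + m" by (metis le_Suc_ex)
  have m: "n - k = Suc m" "n - Suc k = m" "k \<le> n" using n by auto
  have "((q ^ Suc k - 1) * qbinom q n (Suc k)) * (qfact q k * qfact q m) = qfact q n"
    using qbinom_qfact[OF True, of q] by (simp only: m qfact_Suc mult_ac)
  also have "\<dots> = ((q ^ Suc m - 1) * qbinom q n k) * (qfact q k * qfact q m)"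
    using qbinom_qfact[OF m(3), of q] by (simp only: m qfact_Suc mult_ac)
  finally show ?thesis
    using qfact_pos[OF assms, of k] qfact_pos[OF assms, of m] by (simp add: m del: power_Suc)
qed (auto simp: qbinom_eq_0)

lemma qbinom_absorb:
  assumes "q > 1"
  shows "(q ^ Suc k - 1) * qbinom q (Suc n) (Suc k) = (q ^ Suc n - 1) * qbinom q n k"
proof (cases "k \<le> n")
  case True
  have "((q ^ Suc k - 1) * qbinom q (Suc n) (Suc k)) * (qfact q k * qfact q (n - k)) = qfact q (Suc n)"
    using qbinom_qfact[of "Suc k" "Suc n" q] True by (simp only: qfact_Suc mult_ac diff_Suc_Suc Suc_le_mono)
  also have "\<dots> = ((q ^ Suc n - 1) * qbinom q n k) * (qfact q k * qfact q (n - k))"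
    using qbinom_qfact[OF True, of q] by (simp add: qfact_Suc del: power_Suc)
  finally show ?thesis
    using qfact_pos[OF assms, of k] qfact_pos[OF assms, of "n - k"] by (simp del: power_Suc qbinom.simps)
qed (auto simp: qbinom_eq_0)

lemma qbinom_Pascal2:
  assumes "q > 1" "k \<le> n"
  shows "qbinom q (Suc n) (Suc k) = qbinom q n (Suc k) + q ^ (n - k) * qbinom q n k"
proof -
  have "(q ^ Suc k - 1) * qbinom q (Suc n) (Suc k) = (q ^ (n - k) * q ^ Suc k - 1) * qbinom q n k"
    unfolding qbinom_absorb[OF assms(1)] using assms(2) by (simp flip: power_add)
  also have "\<dots> = (q ^ (n - k) - 1) * qbinom q n k + (q ^ Suc k - 1) * (q ^ (n - k) * qbinom q n k)"
    by (simp add: algebra_simps)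
  also have "\<dots> = (q ^ Suc k - 1) * (qbinom q n (Suc k) + q ^ (n - k) * qbinom q n k)"
    unfolding qbinom_Suc_right[OF assms(1), symmetric] by (simp only: distrib_left)
  finally show ?thesis
    using power_Suc_gt1[OF assms(1), of k] by (metis diff_gt_0_iff_gt less_irrefl mult_left_cancel)
qed

lemma qbinom_mult:
  assumes "q > 1" "l \<le> k"
  shows "qbinom q n k * qbinom q k l = qbinom q n l * qbinom q (n - l) (k - l)"
proof (cases "k \<le> n")
  case True
  have "n - l - (k - l) = n - k" "l \<le> n" "k - l \<le> n - l" using assms True by auto
  moreover have "qfact q m \<noteq> 0" for m using qfact_pos[OF assms(1), of m] by simp
  ultimately show ?thesis using True assms by (simp add: qbinom_eq)
next
  case False
  then have "n < k" "n - l < k - l \<or> n < l" by linarith+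
  then show ?thesis by (auto simp: qbinom_eq_0)
qed

lemma qbinom_prod:
  assumes "q > 1"
  shows "qbinom q n k * qfact q k = (\<Prod>h<k. q ^ (n - h) - 1)"
proof (induction k)
  case (Suc k)
  have "qbinom q n (Suc k) * qfact q (Suc k) = ((q ^ Suc k - 1) * qbinom q n (Suc k)) * qfact q k"
    by (simp only: qfact_Suc mult_ac)
  also have "\<dots> = (q ^ (n - k) - 1) * (qbinom q n k * qfact q k)"
    unfolding qbinom_Suc_right[OF assms] by (simp only: mult_ac)
  finally show ?case using Suc by (simp add: mult.commute)
qed simp

lemma gauss_coeff_nat:
  assumes "real q > 1"
  shows "gauss_coeff q (int n) (int k) = qbinom (real q) n k"
proof -
  have num: "(\<Prod>h<k. real q powi (int n - int h) - 1) = (\<Prod>h<k. real q ^ (n - h) - 1)"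
  proof (cases "k \<le> n")
    case True
    then show ?thesis by (intro prod.cong) (auto simp: power_int_def nat_diff_distrib)
  next
    case False
    then have "n < k" by simp
    \<comment> \<open>For \<open>k > n\<close> the integer exponents become negative while the
      natural ones are cut off at 0, but the factor at \<open>h = n\<close> is
      \<open>q ^ 0 - 1 = 0\<close> in both products.\<close>
    then have "(\<Prod>h<k. real q powi (int n - int h) - 1) = 0" "(\<Prod>h<k. real q ^ (n - h) - 1) = 0"
      by (intro prod_zero; force)+
    then show ?thesis by (simp only:)
  qed
  have den: "(\<Prod>h<k. real q powi (int k - int h) - 1) = qfact (real q) k"
  proof -
    have "(\<Prod>h<k. real q powi (int k - int h) - 1) = (\<Prod>h<k. real q ^ Suc (k - Suc h) - 1)"
      by (intro prod.cong) (auto simp: power_int_def nat_diff_distrib Suc_diff_Suc simp del: power_Suc)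
    also have "\<dots> = qfact (real q) k"
      unfolding qfact_def by (rule prod.nat_diff_reindex)
    finally show ?thesis .
  qed
  have "gauss_coeff q (int n) (int k) = (\<Prod>h<k. real q ^ (n - h) - 1) / qfact (real q) k"
    by (simp add: gauss_coeff_def prod_dividef num den atLeast0LessThan)
  also have "\<dots> = qbinom (real q) n k"
    using qfact_pos[OF assms, of k] by (simp flip: qbinom_prod[OF assms])
  finally show ?thesis .
qed

section \<open>Finite \<open>q\<close>-differences and \<open>q\<close>-inversion\<close>

lemma choose_2_0 [simp]: "0 choose 2 = (0::nat)" "Suc 0 choose 2 = 0"
  by (simp_all add: binomial_eq_0)

lemma choose_2_Suc: "Suc k choose 2 = (k choose 2) + k"
  by (simp add: numeral_2_eq_2)

text \<open>With the shift operator \<open>E\<close>, the sum for \<open>j\<close> is the product of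
  the factors \<open>E - q ^ l\<close> over \<open>l < j\<close>, expanded by the
  \<open>q\<close>-binomial theorem, applied to \<open>f\<close> and evaluated at 0. The lemma
  appends the factor \<open>E - q ^ j\<close>.\<close>

lemma qbinom_difference:
  fixes f :: "nat \<Rightarrow> real"
  shows "(\<Sum>h\<le>Suc j. (-1) ^ (Suc j - h) * q ^ (Suc j - h choose 2) * qbinom q (Suc j) h * f h)
    = (\<Sum>h\<le>j. (-1) ^ (j - h) * q ^ (j - h choose 2) * qbinom q j h * f (Suc h))
     - q ^ j * (\<Sum>h\<le>j. (-1) ^ (j - h) * q ^ (j - h choose 2) * qbinom q j h * f h)"
    (is "?L = ?A - q ^ j * ?B")
proof -
  let ?c = "\<lambda>j h. (-1) ^ (j - h) * q ^ (j - h choose 2) :: real"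
  have B: "q ^ j * ?B = - (?c (Suc j) 0 * f 0)
      - (\<Sum>h\<le>j. ?c j h * q ^ Suc h * qbinom q j (Suc h) * f (Suc h))"
  proof -
    have "q ^ j * ?B = (\<Sum>h\<le>Suc j. q ^ j * (?c j h * qbinom q j h * f h))"
      by (simp add: sum_distrib_left qbinom_eq_0)
    also have "\<dots> = q ^ j * ?c j 0 * f 0 + (\<Sum>h\<le>j. q ^ j * (?c j (Suc h) * qbinom q j (Suc h) * f (Suc h)))"
      by (simp only: sum.atMost_Suc_shift) simp
    also have "q ^ j * ?c j 0 * f 0 = - (?c (Suc j) 0 * f 0)"
      by (simp add: choose_2_Suc power_add)
    also have "(\<Sum>h\<le>j. q ^ j * (?c j (Suc h) * qbinom q j (Suc h) * f (Suc h)))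
       = - (\<Sum>h\<le>j. ?c j h * q ^ Suc h * qbinom q j (Suc h) * f (Suc h))"
      unfolding sum_negf[symmetric]
    proof (rule sum.cong)
      fix h assume "h \<in> {..j}"
      show "q ^ j * (?c j (Suc h) * qbinom q j (Suc h) * f (Suc h)) = 
         - (?c j h * q ^ Suc h * qbinom q j (Suc h) * f (Suc h))"
      proof (cases "h = j")
        case False
        with \<open>h \<in> _\<close> obtain k where j: "j = Suc h + k" by (metis atMost_iff le_Suc_ex le_neq_implies_less Suc_leI)
        then have *: "j - h = Suc k" "j - Suc h = k" by auto
        show ?thesis unfolding * choose_2_Suc power_add by (simp add: j power_add)
      qed (simp add: qbinom_eq_0)
    qed simp
    finally show ?thesis by simp
  qed
  have "?L = ?c (Suc j) 0 * f 0 + (\<Sum>h\<le>j. ?c j h * qbinom q (Suc j) (Suc h) * f (Suc h))"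
    by (simp only: sum.atMost_Suc_shift) simp
  also have "(\<Sum>h\<le>j. ?c j h * qbinom q (Suc j) (Suc h) * f (Suc h))
     = ?A + (\<Sum>h\<le>j. ?c j h * q ^ Suc h * qbinom q j (Suc h) * f (Suc h))"
    by (simp add: sum.distrib[symmetric] algebra_simps)
  finally show ?thesis unfolding B by simp
qed

text \<open>A constant function is annihilated by the factor \<open>E - 1\<close> of the
  \<open>q\<close>-difference, so the sum vanishes as soon as \<open>j\<close> is positive.\<close>

lemma qbinom_inversion:
  assumes "q > 1"
  shows "(\<Sum>h\<le>j. (-1) ^ (j - h) * q ^ (j - h choose 2) * qbinom q j h) = (if j = 0 then 1 else 0)"
proof (cases j)
  case (Suc k)
  define S where "S j = (\<Sum>h\<le>j. (-1) ^ (j - h) * q ^ (j - h choose 2) * qbinom q j h)" for j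
  have rec: "S (Suc j) = S j - q ^ j * S j" for j
    using qbinom_difference[of j q "\<lambda>_. 1"] unfolding S_def by simp
  have "S (Suc k) = 0"
  proof (induction k)
    case 0
    show ?case by (simp add: S_def)
  next
    case (Suc k)
    then show ?case using rec[of "Suc k"] by simp
  qed
  then show ?thesis by (simp add: S_def Suc)
qed simp

text \<open>Each further difference subtracts two terms with the same power of \<open>q\<close>, so
  \<open>qbinom_Pascal2\<close> turns them into a single coefficient whose lower entry is smaller by
  one.\<close>

lemma qbinom_difference_qbinom:
  assumes "q > 1" "j \<le> b" "b \<le> c"
  shows "(\<Sum>h\<le>j. (-1) ^ (j - h) * q ^ (j - h choose 2) * qbinom q j h * qbinom q (c + h) b)
      = q ^ (j * (c + j - b)) * qbinom q c (b - j)"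
  using assms(2,3)
proof (induction j arbitrary: c)
  case (Suc j)
  have 1: "(\<Sum>h\<le>j. (-1) ^ (j - h) * q ^ (j - h choose 2) * qbinom q j h * qbinom q (c + Suc h) b)
     = q ^ (j * (Suc c + j - b)) * qbinom q (Suc c) (b - j)"
    using Suc.IH[of "Suc c"] Suc.prems by simp
  have 2: "(\<Sum>h\<le>j. (-1) ^ (j - h) * q ^ (j - h choose 2) * qbinom q j h * qbinom q (c + h) b)
     = q ^ (j * (c + j - b)) * qbinom q c (b - j)"
    using Suc.IH[of c] Suc.prems by simp
  obtain m where b: "b = Suc j + m" using Suc.prems le_Suc_ex by metis
  obtain l where c: "c = b + l" using Suc.prems le_Suc_ex by metis
  have bj: "b - j = Suc m" "b - Suc j = m" "m \<le> c" using b c by auto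
  obtain r where e: "Suc c + j - b = Suc r" "c - m = Suc r" "c + Suc j - b = Suc r" "c + j - b = r"
    using b c by auto
  show ?case
    unfolding qbinom_difference 1 2 bj qbinom_Pascal2[OF assms(1) bj(3)]
    unfolding e by (simp add: power_add algebra_simps)
qed simp

text \<open>Here \<open>a = d - i\<close> and \<open>b = n - d - i\<close>.\<close>

definition grassmann_sum :: "real \<Rightarrow> nat \<Rightarrow> nat \<Rightarrow> nat \<Rightarrow> nat \<Rightarrow> real" where
  "grassmann_sum q i a b j =
     (\<Sum>h\<le>j. (-1) ^ (j - h) * q ^ (h * i + (j - h choose 2)) * qbinom q a h
        * qbinom q (a + i - h) (j - h) * qbinom q (b + h) h)"

section \<open>The alternating form of \<open>G_j(i)\<close>\<close>

definition alt_term :: "real \<Rightarrow> nat \<Rightarrow> nat \<Rightarrow> nat \<Rightarrow> nat \<Rightarrow> nat \<Rightarrow> real" where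
  "alt_term q i a b j t =
     q ^ ((j - t choose 2) + t * i + t * t) * qbinom q i (j - t) * qbinom q a t * qbinom q b t"

text \<open>For \<open>i = 0\<close> the first two coefficients multiply to
  \<open>qbinom q a j * qbinom q j h\<close>, and what remains is the \<open>j\<close>-th
  \<open>q\<close>-difference of \<open>qbinom q (b + h) b\<close> in \<open>h\<close>.\<close>

lemma grassmann_sum_0:
  assumes "q > 1"
  shows "grassmann_sum q 0 a b j = q ^ (j * j) * qbinom q a j * qbinom q b j"
proof -
  have "grassmann_sum q 0 a b j = qbinom q a j *
     (\<Sum>h\<le>j. (-1) ^ (j - h) * q ^ (j - h choose 2) * qbinom q j h * qbinom q (b + h) b)"
    unfolding grassmann_sum_def sum_distrib_left
  proof (rule sum.cong)
    fix h assume "h \<in> {..j}"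
    then have *: "qbinom q a h * qbinom q (a - h) (j - h) = qbinom q a j * qbinom q j h"
      using qbinom_mult[OF assms, of h j a] by simp
    have "qbinom q (b + h) h = qbinom q (b + h) b"
      using qbinom_symmetric[OF assms, of h "b + h"] by simp
    then show "(-1) ^ (j - h) * q ^ (h * 0 + (j - h choose 2)) * qbinom q a h
        * qbinom q (a + 0 - h) (j - h) * qbinom q (b + h) h =
       qbinom q a j * ((-1) ^ (j - h) * q ^ (j - h choose 2) * qbinom q j h * qbinom q (b + h) b)"
      using * by (simp add: algebra_simps)
  qed simp
  also have "(\<Sum>h\<le>j. (-1) ^ (j - h) * q ^ (j - h choose 2) * qbinom q j h * qbinom q (b + h) b)
     = q ^ (j * j) * qbinom q b j"
  proof (cases "j \<le> b")
    case True
    then show ?thesis using qbinom_difference_qbinom[OF assms True order_refl] 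
        qbinom_symmetric[OF assms True] by simp
  next
    case False
    \<comment> \<open>\<open>D k c\<close> is the \<open>k\<close>-th \<open>q\<close>-difference
      started at \<open>c\<close>. The \<open>b\<close>-th one is \<open>q ^ (b * c)\<close>, which
      the next factor \<open>E - q ^ b\<close> annihilates, so all differences of order above
      \<open>b\<close> vanish.\<close>
    define D where "D k c = (\<Sum>h\<le>k. (-1) ^ (k - h) * q ^ (k - h choose 2) * qbinom q k h * qbinom q (c + h) b)"
      for k c
    have rec: "D (Suc k) c = D k (Suc c) - q ^ k * D k c" for k c
      using qbinom_difference[of k q "\<lambda>h. qbinom q (c + h) b"] by (simp add: D_def)
    have Db: "D b c = q ^ (b * c)" if "b \<le> c" for c
      using qbinom_difference_qbinom[OF assms order_refl that] that by (simp add: D_def)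
    have 0: "D (Suc b) c = 0" if "b \<le> c" for c
      using that by (simp add: rec power_add Db)
    have "D (Suc b + k) c = 0" if "b \<le> c" for c k
      using that
    proof (induction k arbitrary: c)
      case (Suc k)
      then show ?case using rec[of "Suc b + k" c] by simp
    qed (simp add: 0)
    moreover obtain k where "j = Suc b + k" using False by (metis less_iff_Suc_add not_le add_Suc)
    ultimately have "D j b = 0" by simp
    then show ?thesis using False by (simp add: D_def qbinom_eq_0)
  qed
  finally show ?thesis by simp
qed

text \<open>The recursion keeps \<open>a\<close> and \<open>b\<close> fixed, hence changes both
  \<open>d\<close> and \<open>n\<close>. It holds term by term, by the Pascal rule for the middle
  coefficient, whose upper entry is the only one containing \<open>i\<close>.\<close>

lemma grassmann_sum_Suc:
  assumes "q > 1"
  shows "grassmann_sum q (Suc i) a b (Suc j)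
     = q ^ Suc j * grassmann_sum q i a b (Suc j) - q ^ j * grassmann_sum q i a b j"
proof -
  define F where "F i j h = (-1) ^ (j - h) * q ^ (h * i + (j - h choose 2)) * qbinom q a h
        * qbinom q (a + i - h) (j - h) * qbinom q (b + h) h" for i j h
  have "F (Suc i) (Suc j) h = q ^ Suc j * F i (Suc j) h - q ^ j * F i j h" if "h \<le> j" for h
  proof (cases "h \<le> a")
    case True
    obtain k where j: "j = h + k" using \<open>h \<le> j\<close> le_Suc_ex by blast
    have e: "Suc j - h = Suc k" "j - h = k" "a + Suc i - h = Suc (a + i - h)" using j True by auto
    show ?thesis unfolding F_def e qbinom.simps choose_2_Suc
      by (simp add: j power_add algebra_simps)
  qed (simp add: F_def qbinom_eq_0)
  moreover have "F (Suc i) (Suc j) (Suc j) = q ^ Suc j * F i (Suc j) (Suc j)"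
    by (simp add: F_def power_add)
  ultimately have "(\<Sum>h\<le>Suc j. F (Suc i) (Suc j) h)
      = (\<Sum>h\<le>j. q ^ Suc j * F i (Suc j) h - q ^ j * F i j h) + q ^ Suc j * F i (Suc j) (Suc j)"
    by (simp del: power_Suc)
  also have "\<dots> = q ^ Suc j * (\<Sum>h\<le>Suc j. F i (Suc j) h) - q ^ j * (\<Sum>h\<le>j. F i j h)"
    by (simp add: sum_subtractf distrib_left sum_distrib_left del: power_Suc)
  finally show ?thesis
    unfolding grassmann_sum_def F_def[symmetric] .
qed

lemma grassmann_sum_j0: "grassmann_sum q i a b 0 = 1"
  by (simp add: grassmann_sum_def)

text \<open>Both sides agree at \<open>i = 0\<close>, where only \<open>t = j\<close> survives, and
  obey the recursion of \<open>grassmann_sum_Suc\<close>, on the right by the Pascal rule for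
  \<open>qbinom q i (j - t)\<close>. This is a \<open>q\<close>-analogue of the Eberlein polynomial:
  putting \<open>q = 1\<close> in \<open>alt_term\<close> leaves a product of three binomial
  coefficients.\<close>

lemma grassmann_sum_alternating:
  assumes "q > 1"
  shows "grassmann_sum q i a b j = (\<Sum>t\<le>j. (-1) ^ (j - t) * alt_term q i a b j t)"
proof (induction i arbitrary: j)
  case 0
  have "(\<Sum>t\<le>j. (-1) ^ (j - t) * alt_term q 0 a b j t)
     = (\<Sum>t\<in>{j}. (-1) ^ (j - t) * alt_term q 0 a b j t)"
    by (rule sum.mono_neutral_right) (auto simp: alt_term_def qbinom_eq_0)
  then show ?case by (simp add: grassmann_sum_0 assms alt_term_def)
next
  case (Suc i)
  show ?case
  proof (cases j)
    case 0
    then show ?thesis by (simp add: grassmann_sum_j0 alt_term_def)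
  next
    case (Suc k)
    have *: "alt_term q (Suc i) a b (Suc k) t = q ^ Suc k * alt_term q i a b (Suc k) t + q ^ k * alt_term q i a b k t"
      if "t \<le> k" for t
    proof -
      obtain l where k: "k = t + l" using \<open>t \<le> k\<close> le_Suc_ex by blast
      have e: "Suc k - t = Suc l" "k - t = l" using k by auto
      show ?thesis unfolding alt_term_def e qbinom.simps choose_2_Suc
        by (simp add: k power_add algebra_simps)
    qed
    have top: "alt_term q (Suc i) a b (Suc k) (Suc k) = q ^ Suc k * alt_term q i a b (Suc k) (Suc k)"
      by (simp add: alt_term_def power_add)
    have s: "(-1::real) ^ (Suc k - t) = - ((-1) ^ (k - t))" if "t \<le> k" for t
      using that by (simp add: Suc_diff_le)
    have "(\<Sum>t\<le>Suc k. (-1) ^ (Suc k - t) * alt_term q (Suc i) a b (Suc k) t)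
       = q ^ Suc k * (\<Sum>t\<le>Suc k. (-1) ^ (Suc k - t) * alt_term q i a b (Suc k) t)
        - q ^ k * (\<Sum>t\<le>k. (-1) ^ (k - t) * alt_term q i a b k t)"
      by (simp add: sum_distrib_left top sum_subtractf[symmetric] * s distrib_left sum.distrib[symmetric]
           right_diff_distrib sum_negf[symmetric] del: power_Suc) (simp add: algebra_simps)
    then show ?thesis using Suc Suc.IH grassmann_sum_Suc[OF assms] by simp
  qed
qed

lemma grassmann_G_eq_sum:
  assumes "q > 1" "2 * d \<le> n" "j \<le> d" "i \<le> d"
  shows "grassmann_G q n d j i = grassmann_sum (real q) i (d - i) (n - d - i) j"
  unfolding grassmann_G_def grassmann_sum_def atLeast0AtMost
proof (rule sum.cong)
  fix h assume "h \<in> {..j}"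
  have e: "int d - int i = int (d - i)" "int d - int h = int (d - h)" "int j - int h = int (j - h)"
    "int n - int d - int i + int h = int (n - d - i + h)" "d - i + i - h = d - h"
    using assms \<open>h \<in> _\<close> by auto
  have "real q > 1" using assms by simp
  then show "(-1) ^ (j - h) * real q ^ (h * i + (j - h choose 2)) * gauss_coeff q (int d - int i) (int h)
        * gauss_coeff q (int d - int h) (int j - int h)
        * gauss_coeff q (int n - int d - int i + int h) (int h) =
     (-1) ^ (j - h) * real q ^ (h * i + (j - h choose 2)) * qbinom (real q) (d - i) h
        * qbinom (real q) (d - i + i - h) (j - h) * qbinom (real q) (n - d - i + h) h"
    unfolding e by (simp only: gauss_coeff_nat)
qed simp

section \<open>Comparing the numbers \<open>G\<^sub>j(i)\<close>\<close>

lemma alt_term_nonneg: "q \<ge> 0 \<Longrightarrow> alt_term q i a b j t \<ge> 0"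
  by (simp add: alt_term_def qbinom_nonneg)

lemma alt_term_eq_0: "a < t \<Longrightarrow> alt_term q i a b j t = 0"
  by (simp add: alt_term_def qbinom_eq_0)

text \<open>The ratio of two consecutive terms, cross-multiplied so that vanishing terms are
  covered. Each of the three Gaussian coefficients moves by one lower index, via
  \<open>qbinom_Suc_right\<close>.\<close>

lemma alt_term_step_eq:
  assumes q: "q > 1" and t: "Suc t \<le> j"
  shows "(q ^ (j - t) - 1) * (q ^ (a - t) - 1) * (q ^ (b - t) - 1) * (q ^ (i + 2 * t + 1) * alt_term q i a b j t)
    = (q ^ (i - (j - Suc t)) - 1) * (q ^ Suc t - 1)\<^sup>2 * (q ^ (j - Suc t) * alt_term q i a b j (Suc t))"
proof -
  obtain s where j: "j = Suc t + s" using t le_Suc_ex by blast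
  have e: "j - t = Suc s" "j - Suc t = s" using j by auto
  define P where "P = q ^ (i + 2 * t + 1 + (s choose 2) + s + t * i + t * t)"
  have "(q ^ (j - t) - 1) * (q ^ (a - t) - 1) * (q ^ (b - t) - 1) * (q ^ (i + 2 * t + 1) * alt_term q i a b j t)
    = P * ((q ^ Suc s - 1) * qbinom q i (Suc s)) * ((q ^ (a - t) - 1) * qbinom q a t)
      * ((q ^ (b - t) - 1) * qbinom q b t)"
  proof -
    have "P = q ^ (i + 2 * t + 1) * q ^ ((Suc s choose 2) + t * i + t * t)"
      unfolding P_def power_add[symmetric] choose_2_Suc by (rule arg_cong[where f = "power q"]) simp
    then show ?thesis
      by (simp only: alt_term_def e mult_ac)
  qed
  also have "\<dots> = P * ((q ^ (i - s) - 1) * qbinom q i s) * ((q ^ Suc t - 1) * qbinom q a (Suc t))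
      * ((q ^ Suc t - 1) * qbinom q b (Suc t))"
    by (simp only: qbinom_Suc_right[OF q])
  also have "\<dots> = (q ^ (i - (j - Suc t)) - 1) * (q ^ Suc t - 1)\<^sup>2 * (q ^ (j - Suc t) * alt_term q i a b j (Suc t))"
  proof -
    have "P = q ^ s * q ^ ((s choose 2) + Suc t * i + Suc t * Suc t)"
      unfolding P_def power_add[symmetric] by (rule arg_cong[where f = "power q"]) simp
    then show ?thesis
      by (simp only: alt_term_def e power2_eq_square mult_ac)
  qed
  finally show ?thesis .
qed

text \<open>In the exact ratio the subtracted ones on the right are dropped. The powers then collect
  to \<open>q ^ (i + 2 * t + 2)\<close>, one more than on the left, whence the single factor
  \<open>q\<close>. If \<open>j - Suc t > i\<close>, both terms are zero.\<close>

lemma alt_term_step: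
  assumes q: "q > 1" and t: "Suc t \<le> j" "Suc t \<le> a" "a \<le> b"
  shows "(q ^ (j - t) - 1) * (q ^ (a - t) - 1) * (q ^ (b - t) - 1) * alt_term q i a b j t
     \<le> q * alt_term q i a b j (Suc t)"
proof (cases "j - Suc t \<le> i")
  case True
  have p: "q ^ k \<ge> 1" for k using q by simp
  have nn: "alt_term q i a b j (Suc t) \<ge> 0" using q by (simp add: alt_term_nonneg)
  have "(q ^ (i - (j - Suc t)) - 1) * (q ^ Suc t - 1)\<^sup>2 \<le> q ^ (i - (j - Suc t)) * (q ^ Suc t)\<^sup>2"
    using p q by (intro mult_mono power_mono) (auto simp del: power_Suc)
  then have "q ^ (i + 2 * t + 1) * ((q ^ (j - t) - 1) * (q ^ (a - t) - 1) * (q ^ (b - t) - 1) * alt_term q i a b j t)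
     \<le> q ^ (i - (j - Suc t)) * (q ^ Suc t)\<^sup>2 * (q ^ (j - Suc t) * alt_term q i a b j (Suc t))"
    unfolding mult.left_commute[of "q ^ (i + 2 * t + 1)"] alt_term_step_eq[OF q t(1), of a b i]
    using nn q by (intro mult_right_mono) auto
  also have "\<dots> = q ^ (i - (j - Suc t) + (2 * Suc t) + (j - Suc t)) * alt_term q i a b j (Suc t)"
    by (simp only: power_add mult_2 mult_2_right power2_eq_square mult_ac)
  also have "i - (j - Suc t) + (2 * Suc t) + (j - Suc t) = (i + 2 * t + 1) + 1"
    using True t(1) by simp
  also have "q ^ ((i + 2 * t + 1) + 1) * alt_term q i a b j (Suc t) = 
     q ^ (i + 2 * t + 1) * (q * alt_term q i a b j (Suc t))"
    by (simp add: mult_ac)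
  finally show ?thesis
    using q by (subst (asm) mult_le_cancel_left_pos) auto
next
  case False
  then have "i < j - t" "i < j - Suc t" using t by auto
  then show ?thesis by (simp add: alt_term_def qbinom_eq_0)
qed

lemma alt_term_mono_bound:
  assumes q: "q > 1" and t: "Suc t \<le> j" "Suc t \<le> a" "a \<le> b"
    and \<alpha>: "\<alpha> \<le> j - t" "\<beta> \<le> a - t" "\<gamma> \<le> b - t"
  shows "(q ^ \<alpha> - 1) * (q ^ \<beta> - 1) * (q ^ \<gamma> - 1) * alt_term q i a b j t
     \<le> q * alt_term q i a b j (Suc t)"
proof -
  have p: "q ^ k \<ge> 1" for k using q by simp
  have m: "k \<le> l \<Longrightarrow> q ^ k \<le> q ^ l" for k l using q by (simp add: power_increasing)
  have "(q ^ \<alpha> - 1) * (q ^ \<beta> - 1) * (q ^ \<gamma> - 1) * alt_term q i a b j t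
    \<le> (q ^ (j - t) - 1) * (q ^ (a - t) - 1) * (q ^ (b - t) - 1) * alt_term q i a b j t"
    using p m \<alpha> q by (intro mult_mono mult_nonneg_nonneg alt_term_nonneg) auto
  also have "\<dots> \<le> q * alt_term q i a b j (Suc t)"
    by (rule alt_term_step[OF q t])
  finally show ?thesis .
qed

section \<open>Alternating sums controlled by their last terms\<close>

lemma alternating_sum_bounds:
  fixes x :: "nat \<Rightarrow> real"
  assumes "\<And>t. x t \<ge> 0" "\<And>t. t < p \<Longrightarrow> x t \<le> x (Suc t)"
  shows "0 \<le> (\<Sum>t\<le>p. (-1) ^ (p - t) * x t) \<and> (\<Sum>t\<le>p. (-1) ^ (p - t) * x t) \<le> x p"
  using assms(2)
proof (induction p)
  case (Suc p)
  have "(\<Sum>t\<le>p. (-1) ^ (Suc p - t) * x t) = (\<Sum>t\<le>p. - ((-1) ^ (p - t) * x t))"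
    by (rule sum.cong) (auto simp: Suc_diff_le)
  moreover have "0 \<le> (\<Sum>t\<le>p. (-1) ^ (p - t) * x t) \<and> (\<Sum>t\<le>p. (-1) ^ (p - t) * x t) \<le> x p"
    using Suc.prems by (intro Suc.IH) simp
  moreover have "x p \<le> x (Suc p)" using Suc.prems by simp
  ultimately show ?case by (simp add: sum_negf)
qed (use assms in auto)

lemma alternating_sum_Suc:
  fixes x :: "nat \<Rightarrow> real"
  shows "(\<Sum>t\<le>Suc p. (-1) ^ (Suc p - t) * x t) = x (Suc p) - (\<Sum>t\<le>p. (-1) ^ (p - t) * x t)"
proof -
  have "(\<Sum>t\<le>p. (-1) ^ (Suc p - t) * x t) = (\<Sum>t\<le>p. - ((-1) ^ (p - t) * x t))"
    by (rule sum.cong) (auto simp: Suc_diff_le)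
  then show ?thesis by (simp add: sum_negf)
qed

lemma grassmann_sum_truncate:
  assumes "q > 1" "p \<le> j" "p = j \<or> p = a"
  shows "grassmann_sum q i a b j = (-1) ^ (j - p) * (\<Sum>t\<le>p. (-1) ^ (p - t) * alt_term q i a b j t)"
proof -
  have "grassmann_sum q i a b j = (\<Sum>t\<le>p. (-1) ^ (j - t) * alt_term q i a b j t)"
    unfolding grassmann_sum_alternating[OF assms(1)]
    using assms(2,3) by (intro sum.mono_neutral_right) (auto intro!: alt_term_eq_0 simp del: mult_eq_0_iff)
  also have "\<dots> = (-1) ^ (j - p) * (\<Sum>t\<le>p. (-1) ^ (p - t) * alt_term q i a b j t)"
    unfolding sum_distrib_left using assms(2)
    by (intro sum.cong) (auto simp: mult.assoc[symmetric] power_add[symmetric])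
  finally show ?thesis .
qed

text \<open>The terms increase once the product of the three factors in
  \<open>alt_term_mono_bound\<close> is at least \<open>q\<close>. At \<open>t = j - 1\<close> all
  three exponents can be 1, and \<open>(q - 1) ^ 3 >= q\<close> fails for \<open>q = 2\<close>; the
  assumption \<open>large\<close> either raises an exponent to 2 or gives
  \<open>q >= 3\<close>.\<close>

lemma grassmann_sum_nonneg_below:
  assumes q: "q \<ge> 2" and "a \<le> b" "j \<le> a"
    and large: "j < a \<or> q \<ge> 3 \<or> a < b"
  shows "grassmann_sum q i a b j \<ge> 0"
proof -
  have q1: "q > 1" using q by simp
  have step: "alt_term q i a b j t \<le> alt_term q i a b j (Suc t)" if "t < j" for t
  proof -
    have x: "alt_term q i a b j t \<ge> 0" using q by (simp add: alt_term_nonneg)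
    consider "j < a" | "q \<ge> 3" | "a < b" using large by blast
    then have "\<exists>c \<ge> q. c * alt_term q i a b j t \<le> q * alt_term q i a b j (Suc t)"
    proof cases
      case 1
      have "(q ^ 1 - 1) * (q ^ 2 - 1) * (q ^ 2 - 1) * alt_term q i a b j t \<le> q * alt_term q i a b j (Suc t)"
        using that assms 1 by (intro alt_term_mono_bound q1) auto
      moreover have "q ^ 2 \<ge> 2 * q" using q by (simp add: power2_eq_square)
      then have "1 * q * 1 \<le> (q ^ 1 - 1) * (q ^ 2 - 1) * (q ^ 2 - 1)"
        using q by (intro mult_mono) auto
      ultimately show ?thesis by auto
    next
      case 2
      have "(q ^ 1 - 1) * (q ^ 1 - 1) * (q ^ 1 - 1) * alt_term q i a b j t \<le> q * alt_term q i a b j (Suc t)"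
        using that assms by (intro alt_term_mono_bound q1) auto
      moreover have "(q - 1) * 2 * 2 \<le> (q ^ 1 - 1) * (q ^ 1 - 1) * (q ^ 1 - 1)"
        using 2 by (intro mult_mono) auto
      then have "q \<le> (q ^ 1 - 1) * (q ^ 1 - 1) * (q ^ 1 - 1)"
        by (rule order_trans[rotated]) (use 2 in simp)
      ultimately show ?thesis by auto
    next
      case 3
      have "(q ^ 1 - 1) * (q ^ 1 - 1) * (q ^ 2 - 1) * alt_term q i a b j t \<le> q * alt_term q i a b j (Suc t)"
        using that assms 3 by (intro alt_term_mono_bound q1) auto
      moreover have "q ^ 2 \<ge> 2 * q" using q by (simp add: power2_eq_square)
      then have "1 * 1 * q \<le> (q ^ 1 - 1) * (q ^ 1 - 1) * (q ^ 2 - 1)"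
        using q by (intro mult_mono) auto
      ultimately show ?thesis by auto
    qed
    then obtain c where "c \<ge> q" "c * alt_term q i a b j t \<le> q * alt_term q i a b j (Suc t)" by blast
    then have "q * alt_term q i a b j t \<le> q * alt_term q i a b j (Suc t)"
      using mult_right_mono[OF _ x, of q c] by linarith
    then show ?thesis using q by simp
  qed
  have "grassmann_sum q i a b j = (\<Sum>t\<le>j. (-1) ^ (j - t) * alt_term q i a b j t)"
    by (simp add: grassmann_sum_alternating q1)
  then show ?thesis
    using alternating_sum_bounds[of "alt_term q i a b j" j] step alt_term_nonneg[of q] q by simp
qed

text \<open>Since \<open>t < a < j\<close>, the exponent \<open>j - t\<close> is at least 2, which
  yields growth by a factor 3/2 instead of mere monotonicity.\<close>

lemma alt_term_step_above:
  assumes q: "q \<ge> 2" and "a \<le> b" "a < j" "t < a"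
  shows "3 * alt_term q i a b j t \<le> 2 * alt_term q i a b j (Suc t)"
proof -
  have x: "alt_term q i a b j t \<ge> 0" using q by (simp add: alt_term_nonneg)
  have "(q ^ 2 - 1) * (q ^ 1 - 1) * (q ^ 1 - 1) * alt_term q i a b j t \<le> q * alt_term q i a b j (Suc t)"
    using q assms by (intro alt_term_mono_bound) auto
  moreover have "q ^ 2 \<ge> 2 * q" using q by (simp add: power2_eq_square)
  then have "(3/2 * q) * 1 * 1 \<le> (q ^ 2 - 1) * (q ^ 1 - 1) * (q ^ 1 - 1)"
  proof (intro mult_mono)
    \<comment> \<open>The root 2 of this quadratic explains the constant 3/2: equality holds at
      \<open>q = 2\<close>.\<close>
    have "0 \<le> (q - 2) * (q + 1/2)" using q by simp
    also have "\<dots> = q ^ 2 - 1 - 3/2 * q" by (simp add: field_simps power2_eq_square)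
    finally show "3/2 * q \<le> q ^ 2 - 1" by simp
  qed (use q in auto)
  ultimately have "3/2 * q * alt_term q i a b j t \<le> q * alt_term q i a b j (Suc t)"
    using mult_right_mono[OF _ x, of "3/2 * q" "(q ^ 2 - 1) * (q ^ 1 - 1) * (q ^ 1 - 1)"] by linarith
  then have "q * (3 * alt_term q i a b j t) \<le> q * (2 * alt_term q i a b j (Suc t))"
    by simp
  then show ?thesis using q by (subst (asm) mult_le_cancel_left_pos) auto
qed

text \<open>Terms beyond \<open>a\<close> vanish, which gives the sign. The partial sum up to
  \<open>a - 1\<close> lies between 0 and its last term, and that is at most two thirds of the term
  at \<open>a\<close>, leaving at least one third.\<close>

lemma grassmann_sum_above:
  assumes q: "q \<ge> 2" and "a \<le> b" "a < j"
  shows "\<exists>y. grassmann_sum q i a b j = (-1) ^ (j - a) * y \<and> alt_term q i a b j a / 3 \<le> y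
     \<and> y \<le> alt_term q i a b j a"
proof -
  let ?x = "alt_term q i a b j"
  define y where "y p = (\<Sum>t\<le>p. (-1) ^ (p - t) * ?x t)" for p
  have x: "?x t \<ge> 0" for t using q by (simp add: alt_term_nonneg)
  have step: "3 * ?x t \<le> 2 * ?x (Suc t)" if "t < a" for t
    using alt_term_step_above[OF assms that] .
  have b: "0 \<le> y p \<and> y p \<le> ?x p" if "p \<le> a" for p
    unfolding y_def
  proof (rule alternating_sum_bounds[OF x])
    fix t assume "t < p"
    then show "?x t \<le> ?x (Suc t)" using step[of t] x[of t] x[of "Suc t"] that by linarith
  qed
  have "?x a / 3 \<le> y a"
  proof (cases a)
    case 0
    then show ?thesis using x[of 0] by (simp add: y_def)
  next
    case (Suc p)
    have "y (Suc p) = ?x (Suc p) - y p"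
      unfolding y_def by (rule alternating_sum_Suc)
    then show ?thesis using step[of p] b[of p] Suc by simp
  qed
  moreover have "grassmann_sum q i a b j = (-1) ^ (j - a) * y a"
    unfolding y_def using grassmann_sum_truncate[of q a j a i b] assms by simp
  ultimately show ?thesis using b[of a] by blast
qed

text \<open>The dominant term at \<open>i = d - j + s\<close>, with \<open>m = d - j\<close> and \<open>e = n - 2 d\<close>.\<close>

definition top_term :: "real \<Rightarrow> nat \<Rightarrow> nat \<Rightarrow> nat \<Rightarrow> nat \<Rightarrow> real" where
  "top_term q m e j s = alt_term q (m + s) (j - s) (e + (j - s)) j (j - s)"

section \<open>Decay of the dominant terms\<close>

lemma top_term_nonneg: "q \<ge> 0 \<Longrightarrow> top_term q m e j s \<ge> 0"
  by (simp add: top_term_def alt_term_nonneg)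

text \<open>From \<open>s\<close> to \<open>Suc s\<close>, with \<open>a = j - Suc s\<close>, one
  coefficient gains \<open>(q ^ Suc (m + s) - 1) / (q ^ Suc s - 1)\<close> and the other gains
  \<open>A / B\<close>, which is at most 1. The rest is bookkeeping of powers of \<open>q\<close>.
  The case \<open>s = 0\<close> is included for the binary comparison.\<close>

lemma top_term_Suc:
  assumes q: "q > 1" and s: "Suc s \<le> j"
  shows "top_term q m e j (Suc s) * ((q ^ Suc s - 1) * q ^ j) \<le> q ^ (2 * s + 1) * top_term q m e j s"
proof -
  obtain a where j: "j = Suc s + a" using s le_Suc_ex by blast
  have ea: "j - s = Suc a" "j - Suc s = a" "j - a = Suc s" "j - Suc a = s" using j by auto
  have p: "q ^ k \<ge> 1" for k using q by simp
  define A B where "A = q ^ Suc a - 1" and "B = q ^ (Suc (e + a)) - 1"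
  have "A \<le> B" unfolding A_def B_def using q by (simp add: power_increasing del: power_Suc)
  have "A > 0" unfolding A_def using power_Suc_gt1[OF q, of a] by simp
  define C where "C = q ^ (s choose 2) * q ^ (a * (m + s) + a * a)" 
  have C: "C \<ge> 0" using q by (simp add: C_def)
  define X where "X = qbinom q (m + s) s * qbinom q (e + a) a"
  have X: "X \<ge> 0" using q by (simp add: X_def qbinom_nonneg)
  have 1: "(q ^ Suc s - 1) * qbinom q (Suc (m + s)) (Suc s) = (q ^ Suc (m + s) - 1) * qbinom q (m + s) s"
    by (rule qbinom_absorb[OF q])
  have 2: "A * qbinom q (Suc (e + a)) (Suc a) = B * qbinom q (e + a) a"
    unfolding A_def B_def by (rule qbinom_absorb[OF q])
  have T1: "top_term q m e j (Suc s) * (q ^ Suc s - 1) = C * q ^ s * q ^ a * (q ^ Suc (m + s) - 1) * X"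
  proof -
    have "top_term q m e j (Suc s) * (q ^ Suc s - 1) =
        C * q ^ s * q ^ a * ((q ^ Suc s - 1) * qbinom q (Suc (m + s)) (Suc s)) * qbinom q (e + a) a"
      by (simp add: top_term_def alt_term_def ea C_def choose_2_Suc power_add algebra_simps
            del: power_Suc qbinom.simps)
    then show ?thesis unfolding 1 X_def by (simp only: mult_ac)
  qed
  have T0: "top_term q m e j s * A = C * q ^ (m + s) * q ^ (2 * a + 1) * B * X"
  proof -
    have "top_term q m e j s = C * q ^ (m + s) * q ^ (2 * a + 1) * qbinom q (m + s) s * qbinom q (Suc (e + a)) (Suc a)"
      by (simp add: top_term_def alt_term_def ea C_def power_add mult_2 mult_2_right algebra_simps del: qbinom.simps)
    then have "top_term q m e j s * A = C * q ^ (m + s) * q ^ (2 * a + 1) * qbinom q (m + s) s * (A * qbinom q (Suc (e + a)) (Suc a))"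
      by (simp only: mult_ac)
    then show ?thesis unfolding 2 X_def by (simp only: mult_ac)
  qed
  have "(top_term q m e j (Suc s) * ((q ^ Suc s - 1) * q ^ j)) * A
      = (C * q ^ s * q ^ a * X * q ^ j) * ((q ^ Suc (m + s) - 1) * A)"
    using T1 by (simp only: mult_ac)
  also have "\<dots> \<le> (C * q ^ s * q ^ a * X * q ^ j) * (q ^ Suc (m + s) * B)"
    using \<open>A \<le> B\<close> \<open>A > 0\<close> C X p q
    by (intro mult_left_mono mult_mono) (auto simp del: power_Suc)
  also have "\<dots> = (C * B * X) * q ^ (s + a + j + Suc (m + s))"
    by (simp only: power_add mult_ac)
  also have "s + a + j + Suc (m + s) = (2 * s + 1) + ((m + s) + (2 * a + 1))"
    using j by simp
  also have "(C * B * X) * q ^ \<dots> = q ^ (2 * s + 1) * (top_term q m e j s * A)"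
    unfolding T0 by (simp only: power_add mult_ac)
  finally have "(top_term q m e j (Suc s) * ((q ^ Suc s - 1) * q ^ j)) * A \<le> (q ^ (2 * s + 1) * top_term q m e j s) * A"
    by (simp only: mult_ac)
  then show ?thesis using \<open>A > 0\<close> by simp
qed

lemma top_term_antimono_step:
  assumes q: "q \<ge> 2" and s: "Suc s \<le> j" "1 \<le> s"
  shows "top_term q m e j (Suc s) \<le> top_term q m e j s"
proof -
  have q1: "q > 1" using q by simp
  have "q ^ Suc s \<ge> 2 * q ^ s" using q by simp
  moreover have "q ^ s \<ge> 1" using q by simp
  ultimately have "q ^ Suc s - 1 \<ge> q ^ s" by linarith
  then have "top_term q m e j (Suc s) * (q ^ s * q ^ j) \<le> top_term q m e j (Suc s) * ((q ^ Suc s - 1) * q ^ j)"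
    using q top_term_nonneg[of q m e j "Suc s"] by (intro mult_left_mono mult_right_mono) auto
  also have "\<dots> \<le> q ^ (2 * s + 1) * top_term q m e j s"
    by (rule top_term_Suc[OF q1 s(1)])
  also have "\<dots> \<le> q ^ (s + j) * top_term q m e j s"
    using q s top_term_nonneg[of q m e j s] by (intro mult_right_mono power_increasing) auto
  finally have "q ^ (s + j) * top_term q m e j (Suc s) \<le> q ^ (s + j) * top_term q m e j s"
    by (simp add: power_add mult_ac)
  then show ?thesis using q by (subst (asm) mult_le_cancel_left_pos) auto
qed

lemma top_term_antimono:
  assumes q: "q \<ge> 2" and "1 \<le> s" "s \<le> s'" "s' \<le> j"
  shows "top_term q m e j s' \<le> top_term q m e j s"
  using assms(3,4)
proof (induction s' rule: dec_induct)
  case (step k)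
  then show ?case using top_term_antimono_step[OF q, of k j m e] assms by fastforce
qed simp

text \<open>Already the step from 1 to 2 loses a factor \<open>q ^ 2 - 1 >= 3\<close>, because
  \<open>j >= 3\<close> absorbs the power \<open>q ^ 3\<close>. The factor 3 matches the lower bound
  of one third in \<open>grassmann_G_above\<close>.\<close>

lemma top_term_3:
  assumes q: "q \<ge> 2" and s: "3 \<le> s" "s \<le> j"
  shows "top_term q m e j s \<le> top_term q m e j 1 / 3"
proof -
  have q1: "q > 1" using q by simp
  have nn: "top_term q m e j 2 \<ge> 0" using q by (simp add: top_term_nonneg)
  have "q ^ 3 * (top_term q m e j 2 * (q ^ 2 - 1)) \<le> top_term q m e j 2 * ((q ^ 2 - 1) * q ^ j)"
  proof -
    have "q ^ 3 \<le> q ^ j" using s q by (intro power_increasing) auto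
    moreover have "q ^ 2 - 1 \<ge> 0" using q by (simp add: one_le_power)
    ultimately show ?thesis using nn mult_right_mono[of "q ^ 3" "q ^ j" "top_term q m e j 2 * (q ^ 2 - 1)"] 
      by (simp add: mult_ac)
  qed
  also have "\<dots> \<le> q ^ 3 * top_term q m e j 1"
    using top_term_Suc[OF q1, of 1 j m e] s by (simp add: numeral_2_eq_2 numeral_3_eq_3)
  finally have "top_term q m e j 2 * (q ^ 2 - 1) \<le> top_term q m e j 1"
    using q by (subst (asm) mult_le_cancel_left_pos) auto
  moreover have "q ^ 2 - 1 \<ge> 3" using mult_mono[of 2 q 2 q] q by (simp add: power2_eq_square)
  then have "top_term q m e j 2 * 3 \<le> top_term q m e j 2 * (q ^ 2 - 1)"
    using nn by (intro mult_left_mono)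
  moreover have "top_term q m e j s \<le> top_term q m e j 2"
    using top_term_antimono[OF q, of 2 s j] s by simp
  ultimately show ?thesis by simp
qed

section \<open>Sign, size and minimum of \<open>G_j(i)\<close>\<close>

lemma grassmann_G_above:
  assumes q: "q \<ge> 2" and n: "2 * d \<le> n" "j \<le> d" and s: "1 \<le> s" "s \<le> j"
  shows "\<exists>y. grassmann_G q n d j (d - j + s) = (-1) ^ s * y \<and> top_term q (d - j) (n - 2 * d) j s / 3 \<le> y
     \<and> y \<le> top_term q (d - j) (n - 2 * d) j s"
proof -
  have e: "d - (d - j + s) = j - s" "n - d - (d - j + s) = n - 2 * d + (j - s)" "j - (j - s) = s"
    using assms by auto
  have "grassmann_G q n d j (d - j + s) = grassmann_sum q (d - j + s) (j - s) (n - 2 * d + (j - s)) j"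
    using grassmann_G_eq_sum[of q d n j "d - j + s"] assms unfolding e by simp
  then show ?thesis
    using grassmann_sum_above[of q "j - s" "n - 2 * d + (j - s)" j "d - j + s"] assms
    unfolding e top_term_def by simp
qed

lemma grassmann_G_below:
  assumes q: "q \<ge> 2" and n: "2 * d \<le> n" "j \<le> d" and i: "i \<le> d - j"
    and large: "i < d - j \<or> q \<ge> 3 \<or> 2 * d < n"
  shows "grassmann_G q n d j i \<ge> 0"
proof -
  have "grassmann_G q n d j i = grassmann_sum q i (d - i) (n - d - i) j"
    using assms by (intro grassmann_G_eq_sum) auto
  also have "\<dots> \<ge> 0"
    using assms by (intro grassmann_sum_nonneg_below) auto
  finally show ?thesis .
qed

lemma grassmann_G_min_generic:
  assumes q: "q \<ge> 3 \<or> q = 2 \<and> n \<ge> 2 * d + 1" and n: "2 * d \<le> n" "1 \<le> j" "j \<le> d" and i: "i \<le> d"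
  shows "grassmann_G q n d j (d - j + 1) \<le> grassmann_G q n d j i"
proof -
  let ?T = "top_term q (d - j) (n - 2 * d) j"
  have q2: "q \<ge> 2" "real q \<ge> 2" using q by auto
  have T: "?T s \<ge> 0" for s by (simp add: top_term_nonneg)
  obtain y where y: "grassmann_G q n d j (d - j + 1) = - y" "?T 1 / 3 \<le> y"
    using grassmann_G_above[OF q2(1) n(1) n(3), of 1] n by auto
  show ?thesis
  proof (cases "i \<le> d - j")
    case True
    have "grassmann_G q n d j i \<ge> 0"
      using q n True by (intro grassmann_G_below q2) auto
    then show ?thesis using y T[of 1] by simp
  next
    case False
    define s where "s = i - (d - j)"
    have s: "i = d - j + s" "1 \<le> s" "s \<le> j" using False i n by (auto simp: s_def)
    obtain z where z: "grassmann_G q n d j i = (-1) ^ s * z" "?T s / 3 \<le> z" "z \<le> ?T s"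
      using grassmann_G_above[OF q2(1) n(1) n(3) s(2,3)] s(1) by auto
    have "z \<ge> 0" using z(2) T[of s] by linarith
    \<comment> \<open>Even \<open>s\<close>, in particular \<open>s = 2\<close>, gives a nonnegative
      value; odd \<open>s\<close> from 3 on is exactly the range of
      \<open>top_term_3\<close>.\<close>
    consider "even s" | "s = 1" | "odd s" "s \<ge> 3"
    proof -
      have "s = 1 \<or> s = 2 \<or> s \<ge> 3" using s(2) by linarith
      then show ?thesis using that by auto
    qed
    then show ?thesis
    proof cases
      case 1
      then show ?thesis using z \<open>z \<ge> 0\<close> y T[of 1] by simp
    next
      case 2
      then show ?thesis using s by simp
    next
      case 3
      then have "?T s \<le> ?T 1 / 3" using s q2 by (intro top_term_3) auto
      then show ?thesis using z y 3 by simp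
    qed
  qed
qed

text \<open>With \<open>x_j\<close> the last term at \<open>i = d - j\<close>, the value there is at
  most \<open>- x_j / 2\<close>, while every value with \<open>i > d - j\<close> has absolute value
  at most \<open>x_j / 2\<close> and every value with \<open>i < d - j\<close> is
  nonnegative.\<close>

lemma grassmann_G_min_binary:
  assumes "7 \<le> j" "j + 5 \<le> d" and i: "i \<le> d"
  shows "grassmann_G 2 (2 * d) d j (d - j) \<le> grassmann_G 2 (2 * d) d j i"
proof -
  define m where "m = d - j"
  have m: "m \<ge> 5" "j \<le> d" using assms by (auto simp: m_def)
  let ?T = "top_term 2 m 0 j"
  let ?x = "alt_term 2 m j j j"
  define y where "y p = (\<Sum>t\<le>p. (-1) ^ (p - t) * ?x t)" for p
  have x: "?x t \<ge> 0" for t by (simp add: alt_term_nonneg)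
  \<comment> \<open>Away from the last step all three exponents are at least 2, and
    \<open>(2 ^ 2 - 1) ^ 3 = 27\<close>.\<close>
  have bound: "27 * ?x t \<le> 2 * ?x (Suc t)" if "Suc t < j" for t
    using alt_term_mono_bound[of 2 t j j j 2 2 2 m] that by simp
  have mono: "?x t \<le> ?x (Suc t)" if "Suc t < j" for t
    using bound[OF that] x[of t] x[of "Suc t"] by linarith
  have "grassmann_G 2 (2 * d) d j m = grassmann_sum 2 m j j j"
    using grassmann_G_eq_sum[of 2 d "2 * d" j m] m assms by (simp add: m_def)
  also have "\<dots> = y j"
    by (simp add: grassmann_sum_alternating y_def)
  finally have Gy: "grassmann_G 2 (2 * d) d j m = y j" .
  obtain k where k: "j = Suc (Suc k)" using assms(1) by (intro that[of "j - 2"]) simp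
  \<comment> \<open>The last two terms are split off, since the final step need not increase. The
    remainder is at most \<open>?x k\<close>, which is at most 2/27 of
    \<open>?x (Suc k)\<close>.\<close>
  have "y j = ?x j - ?x (Suc k) + y k"
    using alternating_sum_Suc[where p = "Suc k" and x = ?x] alternating_sum_Suc[where p = k and x = ?x]
    by (simp only: y_def flip: k)
  also have "y k \<le> ?x k"
    using alternating_sum_bounds[of ?x k] mono k x unfolding y_def by simp
  finally have 1: "y j \<le> ?x j - 25/27 * ?x (Suc k)" using bound[of k] k by simp
  \<comment> \<open>At \<open>t = j - 1\<close> the three factors on the left of
    \<open>alt_term_step_eq\<close> equal 1, so the ratio \<open>?x (Suc k) / ?x j\<close> is
    \<open>(2 ^ m - 1) * (2 ^ j - 1) ^ 2 / 2 ^ (m + 2 * j - 1)\<close>, just below 2. The bounds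
    \<open>m >= 5\<close> and \<open>j >= 7\<close> give at least
    \<open>2 * (31/32) * (127/128) ^ 2 > 1.9\<close>.\<close>
  have 2: "1.9 * ?x j \<le> ?x (Suc k)"
  proof -
    have "2 ^ (m + 2 * Suc k + 1) * ?x (Suc k) = (2 ^ m - 1) * (2 ^ j - 1)\<^sup>2 * ?x j"
      using alt_term_step_eq[of 2 "Suc k" j j j m] k by simp
    moreover have "(31/32 * 2 ^ m) * (127/128 * 2 ^ j)\<^sup>2 * ?x j \<le> (2 ^ m - 1) * (2 ^ j - 1)\<^sup>2 * ?x j"
    proof (intro mult_right_mono mult_mono power_mono x)
      have "(2::real) ^ 5 \<le> 2 ^ m" using m by (intro power_increasing) auto
      then show "31/32 * 2 ^ m \<le> (2::real) ^ m - 1" by simp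
      have "(2::real) ^ 7 \<le> 2 ^ j" using assms by (intro power_increasing) auto
      then show "127/128 * 2 ^ j \<le> (2::real) ^ j - 1" by simp
    qed auto
    moreover have "(31/32 * 2 ^ m) * (127/128 * 2 ^ j)\<^sup>2 * ?x j 
       = 2 ^ (m + 2 * Suc k + 1) * (31/32 * (127/128)\<^sup>2 * 2 * ?x j)"
      by (simp add: k power_add power2_eq_square power_mult_distrib mult_ac power_mult)
    ultimately have "2 ^ (m + 2 * Suc k + 1) * (31/32 * (127/128)\<^sup>2 * 2 * ?x j) \<le> 2 ^ (m + 2 * Suc k + 1) * ?x (Suc k)"
      by linarith
    then have "31/32 * (127/128)\<^sup>2 * 2 * ?x j \<le> ?x (Suc k)"
      by (subst (asm) mult_le_cancel_left_pos) auto
    then show ?thesis using x[of j] by (simp add: power2_eq_square)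
  qed
  \<comment> \<open>Numerically, \<open>1 - 1.9 * 25/27\<close> is below -1/2.\<close>
  have yj: "y j \<le> - ?x j / 2" using 1 2 x[of j] by simp
  \<comment> \<open>The dominant term at \<open>s = 0\<close> is \<open>?x j\<close> itself, and the
    step to \<open>s = 1\<close> multiplies it by at most \<open>2 / 2 ^ j\<close>.\<close>
  have T1: "?T 1 \<le> ?x j / 2"
  proof -
    have "?T 1 * 2 ^ j \<le> 2 * ?x j"
      using top_term_Suc[of 2 0 j m 0] assms by (simp add: top_term_def)
    moreover have "(2::real) ^ 2 \<le> 2 ^ j" using assms by (intro power_increasing) auto
    then have "?T 1 * 4 \<le> ?T 1 * 2 ^ j" by (intro mult_left_mono) (auto simp: top_term_nonneg)
    ultimately show ?thesis by simp
  qed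
  consider "i < m" | "i = m" | "i > m" by linarith
  then show ?thesis
  proof cases
    case 1
    then have "grassmann_G 2 (2 * d) d j i \<ge> 0"
      using m by (intro grassmann_G_below) (auto simp: m_def)
    then show ?thesis using Gy yj x[of j] by (simp add: m_def)
  next
    case 3
    define s where "s = i - m"
    have s: "i = d - j + s" "1 \<le> s" "s \<le> j" using 3 i m by (auto simp: s_def m_def)
    obtain z where z: "grassmann_G 2 (2 * d) d j i = (-1) ^ s * z" "?T s / 3 \<le> z" "z \<le> ?T s"
      using grassmann_G_above[of 2 d "2 * d" j s] s m by (auto simp: m_def)
    have "z \<ge> 0" using z(2) top_term_nonneg[of 2 m 0 j s] by linarith
    have "?T s \<le> ?T 1" using s by (intro top_term_antimono) auto
    moreover have "- z \<le> (-1) ^ s * z" using \<open>z \<ge> 0\<close> by (cases "even s") auto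
    ultimately have "- (?x j / 2) \<le> grassmann_G 2 (2 * d) d j i" using z T1 by linarith
    then show ?thesis using Gy yj by (simp add: m_def)
  qed (simp add: m_def)
qed

section \<open>Linear algebra and subspace counting\<close>

lemma sum_card_swap:
  fixes f :: "'b \<Rightarrow> real"
  assumes "finite A" "finite B"
  shows "(\<Sum>a\<in>A. \<Sum>b | b \<in> B \<and> R a b. f b) = (\<Sum>b\<in>B. real (card {a \<in> A. R a b}) * f b)"
  by (subst sum.swap_restrict[OF assms]) simp

text \<open>Gaussian elimination, one equation at a time: a pivot \<open>b0\<close> in row
  \<open>a\<close> removes one equation and one unknown, and the value at \<open>b0\<close> is
  recovered afterwards. Indexing by arbitrary finite sets lets rows and columns be
  subspaces.\<close>

lemma nonzero_kernel:
  fixes K :: "'a \<Rightarrow> 'b \<Rightarrow> real"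
  assumes "finite A" "finite B" "card A < card B"
  shows "\<exists>f. (\<exists>b\<in>B. f b \<noteq> 0) \<and> (\<forall>a\<in>A. (\<Sum>b\<in>B. K a b * f b) = 0)"
  using assms
proof (induction A arbitrary: B K rule: finite_induct)
  case empty
  then have "B \<noteq> {}" by auto
  then show ?case by (intro exI[of _ "\<lambda>_. 1"]) auto
next
  case (insert a A)
  show ?case
  proof (cases "\<forall>b\<in>B. K a b = 0")
    case True
    have "card A < card B" using insert by simp
    then obtain f where "\<exists>b\<in>B. f b \<noteq> 0" "\<forall>a\<in>A. (\<Sum>b\<in>B. K a b * f b) = 0"
      using insert.IH[OF insert.prems(1)] by blast
    then show ?thesis using True by (intro exI[of _ f]) simp
  next
    case False
    then obtain b0 where b0: "b0 \<in> B" "K a b0 \<noteq> 0" by blast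
    let ?B = "B - {b0}"
    have "finite ?B" "card A < card ?B" using insert b0 by simp_all
    from insert.IH[OF this, of "\<lambda>a' b. K a' b - K a' b0 * K a b / K a b0"]
    obtain f where f: "\<exists>b\<in>?B. f b \<noteq> 0"
      "\<forall>a'\<in>A. (\<Sum>b\<in>?B. (K a' b - K a' b0 * K a b / K a b0) * f b) = 0" by blast
    define c where "c = (\<Sum>b\<in>?B. K a b * f b)"
    define g where "g = f(b0 := - c / K a b0)"
    have g: "(\<Sum>b\<in>B. K a' b * g b) = (\<Sum>b\<in>?B. K a' b * f b) - K a' b0 * c / K a b0" for a'
    proof -
      have "(\<Sum>b\<in>?B. K a' b * g b) = (\<Sum>b\<in>?B. K a' b * f b)"
        by (rule sum.cong) (auto simp: g_def)
      then show ?thesis using insert.prems(1) b0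
        by (simp add: sum.remove[of B b0] g_def)
    qed
    have "(\<Sum>b\<in>B. K a' b * g b) = 0" if "a' \<in> A" for a'
    proof -
      have "0 = (\<Sum>b\<in>?B. K a' b * f b - K a' b0 / K a b0 * (K a b * f b))"
        using f(2) that by (simp add: algebra_simps)
      also have "\<dots> = (\<Sum>b\<in>?B. K a' b * f b) - K a' b0 / K a b0 * c"
        unfolding c_def sum_distrib_left by (rule sum_subtractf)
      finally show ?thesis unfolding g by simp
    qed
    moreover have "(\<Sum>b\<in>B. K a b * g b) = 0"
      unfolding g using b0 by (simp add: c_def)
    moreover have "\<exists>b\<in>B. g b \<noteq> 0" using f(1) by (auto simp: g_def)
    ultimately show ?thesis by (intro exI[of _ g]) auto
  qed
qed

text \<open>An eigenvector is a function on the vertices, whatever their order; so the listing given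
  by one direction and any listing chosen in the other both do.\<close>

lemma graph_eigenvalue_iff:
  assumes "finite V"
  shows "graph_eigenvalue V E ev \<longleftrightarrow>
    (\<exists>f. (\<exists>X\<in>V. f X \<noteq> 0) \<and> (\<forall>X\<in>V. (\<Sum>Y | Y \<in> V \<and> E X Y. f Y) = ev * f X))"
    (is "_ \<longleftrightarrow> ?R")
proof -
  have mult: "(adjacency_matrix E vs *\<^sub>v vec (length vs) (\<lambda>r. f (vs ! r))) $ r
      = (\<Sum>Y | Y \<in> V \<and> E (vs ! r) Y. f Y)"
    if vs: "distinct vs" "set vs = V" and r: "r < length vs" for vs f r
  proof -
    have "(adjacency_matrix E vs *\<^sub>v vec (length vs) (\<lambda>r. f (vs ! r))) $ r
      = (\<Sum>s = 0..<length vs. if E (vs ! r) (vs ! s) then f (vs ! s) else 0)"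
      using r by (auto simp: adjacency_matrix_def scalar_prod_def intro!: sum.cong)
    also have "\<dots> = (\<Sum>Y\<in>V. if E (vs ! r) Y then f Y else 0)"
      by (rule sum.reindex_bij_betw) (use vs in \<open>auto intro!: bij_betw_nth\<close>)
    also have "\<dots> = (\<Sum>Y | Y \<in> V \<and> E (vs ! r) Y. f Y)"
      using assms by (simp add: sum.If_cases Int_def)
    finally show ?thesis .
  qed
  show ?thesis
  proof
    assume "graph_eigenvalue V E ev"
    then obtain vs v where vs: "distinct vs" "set vs = V" and v: "v \<in> carrier_vec (length vs)"
      "v \<noteq> 0\<^sub>v (length vs)" "adjacency_matrix E vs *\<^sub>v v = ev \<cdot>\<^sub>v v"
      by (auto simp: graph_eigenvalue_def eigenvalue_def eigenvector_def adjacency_matrix_def)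
    \<comment> \<open>The position of \<open>X\<close> is unique because \<open>vs\<close> is
      distinct; values of \<open>f\<close> outside \<open>V\<close> never enter.\<close>
    define f where "f X = v $ (THE r. r < length vs \<and> vs ! r = X)" for X
    have f: "f (vs ! r) = v $ r" if "r < length vs" for r
    proof -
      have "(THE r'. r' < length vs \<and> vs ! r' = vs ! r) = r"
        using that vs(1) by (intro the_equality) (auto simp: nth_eq_iff_index_eq)
      then show ?thesis by (simp add: f_def)
    qed
    have vf: "v = vec (length vs) (\<lambda>r. f (vs ! r))" using v(1) f by auto
    have "\<exists>X\<in>V. f X \<noteq> 0"
    proof (rule ccontr)
      assume "\<not> ?thesis"
      then have "v = 0\<^sub>v (length vs)" using vs(2) vf by auto
      then show False using v(2) by simp
    qed
    moreover have "(\<Sum>Y | Y \<in> V \<and> E X Y. f Y) = ev * f X" if X: "X \<in> V" for X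
    proof -
      obtain r where r: "r < length vs" "vs ! r = X" using X unfolding vs(2)[symmetric] in_set_conv_nth by blast
      have "(ev \<cdot>\<^sub>v v) $ r = ev * f X" using r v(1) f by auto
      then show ?thesis using mult[OF vs r(1), of f] v(3) r(2) vf by simp
    qed
    ultimately show ?R by blast
  next
    assume ?R
    then obtain f where f: "\<exists>X\<in>V. f X \<noteq> 0" "\<And>X. X \<in> V \<Longrightarrow> (\<Sum>Y | Y \<in> V \<and> E X Y. f Y) = ev * f X"
      by blast
    obtain vs where vs: "distinct vs" "set vs = V" using finite_distinct_list[OF assms] by blast
    let ?v = "vec (length vs) (\<lambda>r. f (vs ! r))"
    have "adjacency_matrix E vs *\<^sub>v ?v = ev \<cdot>\<^sub>v ?v"
    proof (rule eq_vecI)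
      fix r assume "r < dim_vec (ev \<cdot>\<^sub>v ?v)"
      then have r: "r < length vs" by simp
      then have "vs ! r \<in> V" using vs(2) nth_mem by blast
      then show "(adjacency_matrix E vs *\<^sub>v ?v) $ r = (ev \<cdot>\<^sub>v ?v) $ r"
        using mult[OF vs r, of f] f(2) r by simp
    qed (simp add: adjacency_matrix_def)
    moreover have "?v \<noteq> 0\<^sub>v (length vs)"
    proof -
      obtain X where "X \<in> V" "f X \<noteq> 0" using f(1) by blast
      then obtain r where "r < length vs" "f (vs ! r) \<noteq> 0" unfolding vs(2)[symmetric] in_set_conv_nth by blast
      then have "?v $ r \<noteq> 0\<^sub>v (length vs) $ r" by simp
      then show ?thesis by metis
    qed
    ultimately have "eigenvector (adjacency_matrix E vs) ?v ev"
      by (simp add: eigenvector_def adjacency_matrix_def)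
    then show "graph_eigenvalue V E ev"
      using vs unfolding graph_eigenvalue_def eigenvalue_def by blast
  qed
qed

section \<open>\<open>q\<close>-integers and the inversion on intersection dimensions\<close>

definition qint :: "real \<Rightarrow> nat \<Rightarrow> real" where
  "qint q k = (q ^ k - 1) / (q - 1)"

lemma qint_0 [simp]: "qint q 0 = 0"
  by (simp add: qint_def)

lemma qint_1 [simp]: "q > 1 \<Longrightarrow> qint q (Suc 0) = 1"
  by (simp add: qint_def)

lemma qint_pos: "q > 1 \<Longrightarrow> k > 0 \<Longrightarrow> qint q k > 0"
  by (simp add: qint_def)

text \<open>For \<open>q\<close> the field size, this is the number of maximal chains between two
  nested subspaces whose dimensions differ by \<open>k\<close>; it arises from iterating
  \<open>up\<close> or \<open>down\<close>.\<close>

definition qint_fact :: "real \<Rightarrow> nat \<Rightarrow> real" where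
  "qint_fact q k = (\<Prod>l<k. qint q (Suc l))"

lemma qint_fact_pos: "q > 1 \<Longrightarrow> qint_fact q k > 0"
  unfolding qint_fact_def by (intro prod_pos) (simp add: qint_pos)

lemma prod_qint:
  assumes "q > 1"
  shows "(\<Prod>l<k. qint q (n - l)) = qbinom q n k * qint_fact q k"
proof -
  have "(\<Prod>l<k. qint q (n - l)) = (qbinom q n k * qfact q k) / (q - 1) ^ k"
    unfolding qbinom_prod[OF assms] by (simp add: qint_def prod_dividef)
  also have "\<dots> = qbinom q n k * qint_fact q k"
    by (simp add: qint_fact_def qfact_def qint_def prod_dividef)
  finally show ?thesis .
qed

lemma qbinom_pos: "q > 1 \<Longrightarrow> k \<le> n \<Longrightarrow> qbinom q n k > 0"
  by (simp add: qbinom_eq qfact_pos)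

text \<open>To be read with \<open>r\<close> the dimension of an intersection: the combination of
  the counts \<open>qbinom q r (d - h)\<close> detects \<open>r = d - j\<close>. Factoring out
  \<open>qbinom q r (d - j)\<close> reduces it to \<open>qbinom_inversion\<close>.\<close>

lemma qbinom_inversion_shifted:
  assumes q: "q > 1" and "j \<le> d" "r \<le> d"
  shows "(\<Sum>h\<le>j. (-1) ^ (j - h) * q ^ (j - h choose 2) * qbinom q (d - h) (j - h) * qbinom q r (d - h))
    = (if r + j = d then 1 else 0)"
proof -
  define k where "k = r - (d - j)"
  have "(\<Sum>h\<le>j. (-1) ^ (j - h) * q ^ (j - h choose 2) * qbinom q (d - h) (j - h) * qbinom q r (d - h))
     = (\<Sum>h\<le>j. qbinom q r (d - j) * ((-1) ^ (j - h) * q ^ (j - h choose 2) * qbinom q k (j - h)))"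
  proof (rule sum.cong)
    fix h assume "h \<in> {..j}"
    then have h: "d - h - (d - j) = j - h" "d - j \<le> d - h" "j - h \<le> d - h" "d - h - (j - h) = d - j" 
      using assms by auto
    have "qbinom q (d - h) (j - h) = qbinom q (d - h) (d - j)"
      using qbinom_symmetric[OF q h(3)] h(4) by simp
    moreover have "qbinom q r (d - h) * qbinom q (d - h) (d - j) = qbinom q r (d - j) * qbinom q k (j - h)"
      using qbinom_mult[OF q h(2), of r] h(1) by (simp add: k_def)
    ultimately show "(-1) ^ (j - h) * q ^ (j - h choose 2) * qbinom q (d - h) (j - h) * qbinom q r (d - h)
      = qbinom q r (d - j) * ((-1) ^ (j - h) * q ^ (j - h choose 2) * qbinom q k (j - h))"
      by (simp add: algebra_simps)
  qed simp
  also have "\<dots> = qbinom q r (d - j) * (\<Sum>h\<le>j. (-1) ^ (j - h) * q ^ (j - h choose 2) * qbinom q k (j - h))"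
    by (simp add: sum_distrib_left)
  \<comment> \<open>Reversing the sum allows its range to shrink from \<open>j\<close> to
    \<open>k <= j\<close>; a second reversal restores the shape of
    \<open>qbinom_inversion\<close>.\<close>
  also have "(\<Sum>h\<le>j. (-1) ^ (j - h) * q ^ (j - h choose 2) * qbinom q k (j - h))
    = (\<Sum>u\<le>j. (-1) ^ u * q ^ (u choose 2) * qbinom q k u)"
    by (rule sum.nat_diff_reindex[where n = "Suc j", unfolded lessThan_Suc_atMost diff_Suc_Suc])
  also have "\<dots> = (\<Sum>u\<le>k. (-1) ^ u * q ^ (u choose 2) * qbinom q k u)"
    using assms by (intro sum.mono_neutral_right) (auto simp: k_def qbinom_eq_0)
  also have "\<dots> = (\<Sum>u\<le>k. (-1) ^ (k - u) * q ^ (k - u choose 2) * qbinom q k (k - u))"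
    by (rule sum.nat_diff_reindex[where n = "Suc k", unfolded lessThan_Suc_atMost diff_Suc_Suc, symmetric])
  also have "\<dots> = (\<Sum>u\<le>k. (-1) ^ (k - u) * q ^ (k - u choose 2) * qbinom q k u)"
    by (intro sum.cong) (auto simp: qbinom_symmetric q)
  also have "\<dots> = (if k = 0 then 1 else 0)" by (rule qbinom_inversion[OF q])
  finally have *: "(\<Sum>h\<le>j. (-1) ^ (j - h) * q ^ (j - h choose 2) * qbinom q (d - h) (j - h) * qbinom q r (d - h))
    = qbinom q r (d - j) * (if k = 0 then 1 else 0)" .
  show ?thesis
  \<comment> \<open>Here the truncated difference \<open>k\<close> is 0 although
    \<open>r + j\<close> differs from \<open>d\<close>; the vanishing factor
    \<open>qbinom q r (d - j)\<close> corrects this.\<close>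
  proof (cases "r < d - j")
    case True
    then show ?thesis unfolding * by (simp add: qbinom_eq_0)
  next
    case False
    then have "r + j = d \<longleftrightarrow> k = 0" "k = 0 \<Longrightarrow> r = d - j" using assms by (auto simp: k_def)
    then show ?thesis unfolding * by auto
  qed
qed

section \<open>Counting subspaces over a finite field\<close>

locale finite_field_space = finite_dimensional_vector_space scale Basis
  for scale :: "'k::{field,finite} \<Rightarrow> 'v::ab_group_add \<Rightarrow> 'v" and Basis +
  fixes Q :: real
  assumes Q_card: "Q = real CARD('k)"
begin

lemma card_scalars: "CARD('k) \<ge> 2"
proof -
  have "card {0, 1 :: 'k} \<le> CARD('k)" by (rule card_mono) auto
  then show ?thesis by simp
qed

lemma Q_gt1: "Q > 1"
  using card_scalars by (simp add: Q_card)

lemma card_span_independent: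
  assumes "finite B" "independent B"
  shows "finite (span B) \<and> card (span B) = CARD('k) ^ card B"
  using assms
proof (induction B rule: finite_induct)
  case (insert a B)
  have a: "a \<notin> span B" "independent B"
    using insert by (auto simp: independent_insert)
  let ?f = "\<lambda>(k, y). scale k a + y"
  have "span (insert a B) = ?f ` (UNIV \<times> span B)"
  proof (intro subset_antisym subsetI)
    fix x assume "x \<in> span (insert a B)"
    then obtain k where "x - scale k a \<in> span B" unfolding span_breakdown_eq by blast
    then show "x \<in> ?f ` (UNIV \<times> span B)" by (intro image_eqI[of _ _ "(k, x - scale k a)"]) simp_all
  next
    fix x assume "x \<in> ?f ` (UNIV \<times> span B)"
    then obtain k y where "x = scale k a + y" "y \<in> span B" by auto
    then show "x \<in> span (insert a B)" unfolding span_breakdown_eq by (intro exI[of _ k]) simp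
  qed
  moreover have "inj_on ?f (UNIV \<times> span B)"
  proof (rule inj_onI, clarify)
    fix k y k' y' assume y: "y \<in> span B" "y' \<in> span B" and eq: "scale k a + y = scale k' a + y'"
    have "y' = scale k a + y - scale k' a" unfolding eq by simp
    then have "scale (k - k') a = y' - y"
      by (simp only: scale_left_diff_distrib cancel_ab_semigroup_add_class.diff_right_commute[of _ "scale k' a" y] add_diff_cancel_right')
    then have *: "scale (k - k') a \<in> span B" using y by (simp add: span_diff)
    have "k = k'"
    proof (rule ccontr)
      assume "k \<noteq> k'"
      then have "a = scale (inverse (k - k')) (scale (k - k') a)" by simp
      then show False using span_scale[OF *, of "inverse (k - k')"] a(1) by simp
    qed
    then show "k = k' \<and> y = y'" using eq by simp
  qed
  ultimately show ?case
    using insert.IH[OF a(2)] insert.hyps by (simp add: card_image card_cartesian_product)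
qed simp

lemma finite_vectors [simp]: "finite (A :: 'v set)"
  using card_span_independent[OF finite_Basis independent_Basis] span_Basis
  by (metis finite_subset subset_UNIV)

lemma finite_vector_sets [simp]: "finite (A :: 'v set set)"
  by (rule finite_subset[OF _ finite_Pow_iff[THEN iffD2, OF finite_vectors[of UNIV]]]) auto

lemma card_subspace: "subspace S \<Longrightarrow> card S = CARD('k) ^ dim S"
  using basis_subspace_exists[of S] card_span_independent by metis

definition covers :: "'v set \<Rightarrow> 'v set \<Rightarrow> bool" where
  "covers Y X \<longleftrightarrow> subspace Y \<and> subspace X \<and> Y \<subseteq> X \<and> dim X = Suc (dim Y)"

text \<open>Each vector of \<open>R - Z\<close> lies in exactly one cover of \<open>Z\<close>, the
  span of \<open>Z\<close> and that vector. So the sets \<open>Y - Z\<close> partition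
  \<open>R - Z\<close> into parts of size \<open>Q ^ dim Z * (Q - 1)\<close>.\<close>

lemma card_covers_between:
  assumes "subspace Z" "subspace R" "Z \<subseteq> R"
  shows "real (card {Y. covers Z Y \<and> Y \<subseteq> R}) = qint Q (dim R - dim Z)"
proof -
  let ?C = "{Y. covers Z Y \<and> Y \<subseteq> R}"
  have sZ: "span Z = Z" using assms(1) by simp
  have dim_ins: "dim (span (insert v Z)) = Suc (dim Z)" if "v \<notin> Z" for v
    unfolding dim_span dim_insert sZ using that by simp
  have cover: "span (insert v Z) \<in> ?C" if "v \<in> R - Z" for v
  proof -
    have "span (insert v Z) \<subseteq> R" using that assms(2,3) by (intro span_minimal) auto
    moreover have "Z \<subseteq> span (insert v Z)" using span_superset[of "insert v Z"] by blast
    ultimately show ?thesis using that assms(1) dim_ins[of v] subspace_span by (simp add: covers_def)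
  qed
  have uniq: "Y = span (insert v Z)" if "Y \<in> ?C" "v \<in> Y - Z" for v Y
  proof -
    have Y: "subspace Y" "Z \<subseteq> Y" "dim Y = Suc (dim Z)" using that(1) by (auto simp: covers_def)
    then have "span (insert v Z) \<subseteq> Y" using that(2) by (intro span_minimal) auto
    then have "span (insert v Z) = Y"
      using Y that(2) dim_ins[of v] by (intro subspace_dim_equal subspace_span) auto
    then show ?thesis ..
  qed
  have "R - Z = (\<Union>Y\<in>?C. Y - Z)"
  proof (intro Set.set_eqI iffI)
    fix v assume v: "v \<in> R - Z"
    then have "v \<in> span (insert v Z) - Z" using span_base[of v "insert v Z"] by simp
    then show "v \<in> (\<Union>Y\<in>?C. Y - Z)" using cover[OF v] by blast
  qed auto
  then have "card (R - Z) = card (\<Union>Y\<in>?C. Y - Z)" by (rule arg_cong)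
  also have "\<dots> = (\<Sum>Y\<in>?C. card (Y - Z))"
  proof (rule card_UN_disjoint)
    have "Y = Y'" if "Y \<in> ?C" "Y' \<in> ?C" "v \<in> Y - Z" "v \<in> Y' - Z" for Y Y' v
      using uniq[OF that(1,3)] uniq[OF that(2,4)] by simp
    then show "\<forall>Y\<in>?C. \<forall>Y'\<in>?C. Y \<noteq> Y' \<longrightarrow> (Y - Z) \<inter> (Y' - Z) = {}" by blast
  qed simp_all
  finally have "card (R - Z) = (\<Sum>Y\<in>?C. card (Y - Z))" .
  then have "real (card (R - Z)) = (\<Sum>Y\<in>?C. real (card (Y - Z)))" by simp
  also have "\<dots> = (\<Sum>Y\<in>?C. Q ^ dim Z * (Q - 1))"
  proof (rule sum.cong)
    fix Y assume "Y \<in> ?C"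
    then have Y: "subspace Y" "Z \<subseteq> Y" "dim Y = Suc (dim Z)" by (auto simp: covers_def)
    have "real (card (Y - Z)) = real (card Y) - real (card Z)"
      using Y by (simp add: card_Diff_subset card_mono of_nat_diff)
    then show "real (card (Y - Z)) = Q ^ dim Z * (Q - 1)"
      using Y assms by (simp add: card_subspace Q_card algebra_simps)
  qed simp
  finally have 1: "real (card (R - Z)) = real (card ?C) * (Q ^ dim Z * (Q - 1))" by simp
  have le: "dim Z \<le> dim R" using assms by (simp add: dim_subset)
  have "real (card (R - Z)) = real (card R) - real (card Z)"
    using assms by (simp add: card_Diff_subset card_mono of_nat_diff)
  also have "\<dots> = Q ^ dim R - Q ^ dim Z"
    using assms by (simp add: card_subspace Q_card)
  also have "\<dots> = Q ^ dim Z * (Q ^ (dim R - dim Z) - 1)"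
    using le by (simp add: right_diff_distrib flip: power_add)
  finally have "real (card ?C) * (Q - 1) = Q ^ (dim R - dim Z) - 1"
    using 1 Q_gt1 by simp
  then show ?thesis using Q_gt1 by (simp add: qint_def field_simps)
qed

text \<open>The dual count, obtained by double counting inclusions between covers \<open>L\<close>
  of \<open>Z\<close> inside \<open>R\<close> and hyperplanes \<open>H\<close> of \<open>R\<close>
  above \<open>Z\<close>. By induction each \<open>L\<close> lies in \<open>qint Q k\<close> such
  \<open>H\<close>, and each \<open>H\<close> contains \<open>qint Q k\<close> such
  \<open>L\<close>, so both families have the same size.\<close>

lemma card_covered_between:
  assumes "subspace Z" "subspace R" "Z \<subseteq> R"
  shows "real (card {H. covers H R \<and> Z \<subseteq> H}) = qint Q (dim R - dim Z)"
  using assms(1,3)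
proof (induction "dim R - dim Z" arbitrary: Z)
  case 0
  have "{H. covers H R \<and> Z \<subseteq> H} = {}"
  proof -
    have "\<not> Z \<subseteq> H" if "covers H R" for H
      using dim_subset[of Z H] that 0 by (auto simp: covers_def)
    then show ?thesis by blast
  qed
  then show ?case using 0 by simp
next
  case (Suc k)
  show ?case
  \<comment> \<open>Codimension one is treated apart, since \<open>qint Q 0 = 0\<close> cannot be
    cancelled in the double count.\<close>
  proof (cases "k = 0")
    case True
    have "{H. covers H R \<and> Z \<subseteq> H} = {Z}"
    proof -
      have "H = Z" if "covers H R" "Z \<subseteq> H" for H
        using that Suc True by (intro subspace_dim_equal[symmetric]) (auto simp: covers_def)
      moreover have "covers Z R" using Suc True assms by (auto simp: covers_def)
      ultimately show ?thesis by auto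
    qed
    then show ?thesis using True Suc Q_gt1 by (simp flip: Suc.hyps(2))
  next
    case False
    let ?L = "{L. covers Z L \<and> L \<subseteq> R}" and ?H = "{H. covers H R \<and> Z \<subseteq> H}"
    have "(\<Sum>L\<in>?L. \<Sum>H | H \<in> ?H \<and> L \<subseteq> H. 1) = (\<Sum>H\<in>?H. real (card {L \<in> ?L. L \<subseteq> H}) * 1)"
      by (rule sum_card_swap) auto
    also have "\<dots> = (\<Sum>H\<in>?H. qint Q k)"
    proof (rule sum.cong)
      fix H assume H: "H \<in> ?H"
      then have "{L \<in> ?L. L \<subseteq> H} = {L. covers Z L \<and> L \<subseteq> H}" by (auto simp: covers_def)
      moreover have "real (card \<dots>) = qint Q (dim H - dim Z)"
        using H Suc by (intro card_covers_between) (auto simp: covers_def)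
      moreover have "dim H - dim Z = k" using H Suc by (auto simp: covers_def)
      ultimately show "real (card {L \<in> ?L. L \<subseteq> H}) * 1 = qint Q k" by simp
    qed simp
    also have "(\<Sum>L\<in>?L. \<Sum>H | H \<in> ?H \<and> L \<subseteq> H. (1::real)) = (\<Sum>L\<in>?L. qint Q k)"
    proof (rule sum.cong)
      fix L assume L: "L \<in> ?L"
      then have "{H. H \<in> ?H \<and> L \<subseteq> H} = {H. covers H R \<and> L \<subseteq> H}" by (auto simp: covers_def)
      moreover have "real (card \<dots>) = qint Q (dim R - dim L)"
        using L Suc by (intro Suc.hyps(1)) (auto simp: covers_def)
      moreover have "dim R - dim L = k" using L Suc by (auto simp: covers_def)
      ultimately show "(\<Sum>H | H \<in> ?H \<and> L \<subseteq> H. (1::real)) = qint Q k" by simp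
    qed simp
    finally have "real (card ?L) * qint Q k = real (card ?H) * qint Q k" by simp
    moreover have "qint Q k > 0" using False Q_gt1 by (simp add: qint_pos)
    ultimately show ?thesis
      using card_covers_between[of Z R] Suc assms by simp
  qed
qed

text \<open>Double counting of covering pairs in dimensions \<open>m\<close> and
  \<open>Suc m\<close> yields the recursion \<open>qbinom_Suc_right\<close>.\<close>

lemma card_subspaces_within:
  assumes R: "subspace R"
  shows "real (card {Z. subspace Z \<and> Z \<subseteq> R \<and> dim Z = m}) = qbinom Q (dim R) m"
proof (induction m)
  case 0
  have "{Z. subspace Z \<and> Z \<subseteq> R \<and> dim Z = 0} = {{0}}"
    using subspace_0 R by (auto simp: subset_singleton_iff)
  then show ?case by simp
next
  case (Suc m)
  let ?L = "\<lambda>m. {Z. subspace Z \<and> Z \<subseteq> R \<and> dim Z = m}"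
  have "(\<Sum>Z\<in>?L m. \<Sum>Y | Y \<in> ?L (Suc m) \<and> covers Z Y. 1) = (\<Sum>Y\<in>?L (Suc m). real (card {Z \<in> ?L m. covers Z Y}) * 1)"
    by (rule sum_card_swap) auto
  also have "\<dots> = (\<Sum>Y\<in>?L (Suc m). qint Q (Suc m))"
  proof (rule sum.cong)
    fix Y assume Y: "Y \<in> ?L (Suc m)"
    then have "{Z \<in> ?L m. covers Z Y} = {Z. covers Z Y \<and> {0} \<subseteq> Z}"
      by (auto simp: covers_def subspace_0)
    moreover have "real (card \<dots>) = qint Q (dim Y - dim {0})"
      using Y by (intro card_covered_between) (auto simp: subspace_0)
    ultimately show "real (card {Z \<in> ?L m. covers Z Y}) * 1 = qint Q (Suc m)" using Y by simp
  qed simp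
  also have "(\<Sum>Z\<in>?L m. \<Sum>Y | Y \<in> ?L (Suc m) \<and> covers Z Y. (1::real)) = (\<Sum>Z\<in>?L m. qint Q (dim R - m))"
  proof (rule sum.cong)
    fix Z assume Z: "Z \<in> ?L m"
    then have "{Y. Y \<in> ?L (Suc m) \<and> covers Z Y} = {Y. covers Z Y \<and> Y \<subseteq> R}"
      by (auto simp: covers_def)
    moreover have "real (card \<dots>) = qint Q (dim R - m)"
      using Z R card_covers_between[of Z R] by auto
    ultimately show "(\<Sum>Y | Y \<in> ?L (Suc m) \<and> covers Z Y. (1::real)) = qint Q (dim R - m)" by simp
  qed simp
  finally have "qbinom Q (dim R) m * qint Q (dim R - m) = real (card (?L (Suc m))) * qint Q (Suc m)"
    using Suc.IH by simp
  then have "(Q ^ Suc m - 1) * real (card (?L (Suc m))) = (Q ^ Suc m - 1) * qbinom Q (dim R) (Suc m)"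
    unfolding qbinom_Suc_right[OF Q_gt1] using Q_gt1 by (simp add: qint_def mult_ac del: power_Suc)
  then show ?case using power_Suc_gt1[OF Q_gt1, of m] by simp
qed

end

section \<open>The spectrum\<close>

lemma sum_swap_nested:
  fixes f :: "'c \<Rightarrow> real"
  assumes "finite A" "finite B"
    and "\<And>a. a \<in> A \<Longrightarrow> C a = {b \<in> B. R a b}"
  shows "(\<Sum>a\<in>A. \<Sum>b\<in>C a. f b) = (\<Sum>b\<in>B. real (card {a \<in> A. R a b}) * f b)"
  using sum_card_swap[OF assms(1,2), of f R] assms(3) by (simp cong: sum.cong)

text \<open>Induction step for \<open>down_up_iter_harmonic\<close>: adding the commutator scalar of
  dimension \<open>i + k\<close> to the coefficient of \<open>down\<close> after \<open>k\<close>
  applications of \<open>up\<close> gives the coefficient for \<open>k + 1\<close>.\<close>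

lemma qint_step:
  assumes "q > 1" "2 * i + k \<le> n"
  shows "q ^ i * qint q k * qint q (n - 2 * i - k + 1) + (qint q (n - i - k) - qint q (i + k))
    = q ^ i * qint q (Suc k) * qint q (n - 2 * i - k)"
proof -
  obtain r where n: "n = 2 * i + k + r" using assms(2) le_Suc_ex by blast
  have e: "n - 2 * i - k + 1 = Suc r" "n - i - k = i + r" "n - 2 * i - k = r" using n by auto
  have m: "(q - 1) * qint q l = q ^ l - 1" for l using assms(1) by (simp add: qint_def)
  have "(q - 1) * (q - 1) * (q ^ i * qint q k * qint q (Suc r) + (qint q (i + r) - qint q (i + k)))
    = q ^ i * ((q - 1) * qint q k) * ((q - 1) * qint q (Suc r))
      + (q - 1) * ((q - 1) * qint q (i + r) - (q - 1) * qint q (i + k))"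
    by (simp add: algebra_simps)
  also have "\<dots> = q ^ i * ((q - 1) * qint q (Suc k)) * ((q - 1) * qint q r)"
    unfolding m by (simp add: power_add algebra_simps)
  also have "\<dots> = (q - 1) * (q - 1) * (q ^ i * qint q (Suc k) * qint q r)"
    by (simp only: mult_ac)
  finally have "(q - 1) * (q - 1) * (q ^ i * qint q k * qint q (Suc r) + (qint q (i + r) - qint q (i + k)))
    = (q - 1) * (q - 1) * (q ^ i * qint q (Suc k) * qint q r)" .
  then show ?thesis unfolding e using assms(1) by simp
qed

section \<open>The up and down operators\<close>

context finite_field_space
begin

abbreviation "N \<equiv> dimension"

text \<open>The name refers to the support, which moves up by one dimension. Functions live on all
  sets of vectors, and the result is 0 at sets that are not subspaces.\<close>

definition up :: "('v set \<Rightarrow> real) \<Rightarrow> 'v set \<Rightarrow> real" where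
  "up f X = (\<Sum>Y | covers Y X. f Y)"

definition down :: "('v set \<Rightarrow> real) \<Rightarrow> 'v set \<Rightarrow> real" where
  "down f X = (\<Sum>Y | covers X Y. f Y)"

lemma up_scale: "up (\<lambda>X. c * f X) = (\<lambda>X. c * up f X)"
  by (simp add: up_def fun_eq_iff sum_distrib_left)

lemma down_scale: "down (\<lambda>X. c * f X) = (\<lambda>X. c * down f X)"
  by (simp add: down_def fun_eq_iff sum_distrib_left)

lemma up_iter_scale: "(up ^^ h) (\<lambda>X. c * f X) = (\<lambda>X. c * (up ^^ h) f X)"
  by (induction h) (simp_all add: up_scale)

lemma down_iter_scale: "(down ^^ h) (\<lambda>X. c * f X) = (\<lambda>X. c * (down ^^ h) f X)"
  by (induction h) (simp_all add: down_scale)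

lemma up_down_adjoint:
  "(\<Sum>X\<in>UNIV. f X * up g X) = (\<Sum>X\<in>UNIV. down f X * g X)"
proof -
  have "(\<Sum>X\<in>UNIV. f X * up g X) = (\<Sum>X\<in>UNIV. \<Sum>Y | Y \<in> UNIV \<and> covers Y X. f X * g Y)"
    by (simp add: up_def sum_distrib_left)
  also have "\<dots> = (\<Sum>Y\<in>UNIV. \<Sum>X | X \<in> UNIV \<and> covers Y X. f X * g Y)"
    by (rule sum.swap_restrict) auto
  also have "\<dots> = (\<Sum>X\<in>UNIV. down f X * g X)"
    by (simp add: down_def sum_distrib_right)
  finally show ?thesis .
qed

lemma up_down_iter_adjoint:
  "(\<Sum>X\<in>UNIV. f X * (up ^^ h) g X) = (\<Sum>X\<in>UNIV. (down ^^ h) f X * g X)"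
proof (induction h arbitrary: f)
  case (Suc h)
  have "(\<Sum>X\<in>UNIV. f X * (up ^^ Suc h) g X) = (\<Sum>X\<in>UNIV. down f X * (up ^^ h) g X)"
    by (simp add: up_down_adjoint)
  also have "\<dots> = (\<Sum>X\<in>UNIV. (down ^^ h) (down f) X * g X)"
    by (rule Suc.IH)
  finally show ?case by (simp add: funpow_swap1)
qed simp

text \<open>For distinct subspaces of equal dimension, the only possible common upper cover is their
  sum and the only possible common lower cover is their intersection. By the dimension formula both
  exist under the same condition; in all other cases both sets are empty.\<close>

lemma card_common_covers:
  assumes "X \<noteq> Y"
  shows "card {W. covers X W \<and> covers Y W} = card {Z. covers Z X \<and> covers Z Y}"
proof (cases "subspace X \<and> subspace Y \<and> dim X = dim Y")
  case False
  then have "{W. covers X W \<and> covers Y W} = {}" "{Z. covers Z X \<and> covers Z Y} = {}"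
    by (auto simp: covers_def)
  then show ?thesis by (simp only:)
next
  case True
  then have XY: "subspace X" "subspace Y" "dim X = dim Y" by auto
  define S where "S = {x + y |x y. x \<in> X \<and> y \<in> Y}"
  have S: "subspace S" unfolding S_def using XY by (intro subspace_sums)
  have I: "subspace (X \<inter> Y)" using XY by (intro subspace_inter)
  have XS: "X \<subseteq> S"
  proof
    fix x assume "x \<in> X"
    then have "x + 0 \<in> S" unfolding S_def using subspace_0[OF XY(2)] by blast
    then show "x \<in> S" by simp
  qed
  have YS: "Y \<subseteq> S"
  proof
    fix y assume "y \<in> Y"
    then have "0 + y \<in> S" unfolding S_def using subspace_0[OF XY(1)] by blast
    then show "y \<in> S" by simp
  qed
  have Smin: "S \<subseteq> W" if "subspace W" "X \<subseteq> W" "Y \<subseteq> W" for W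
    unfolding S_def using that subspace_add[OF that(1)] by blast
  have sum: "dim S + dim (X \<inter> Y) = 2 * dim X"
    using dim_sums_Int[OF XY(1,2)] XY(3) unfolding S_def by simp
  have lt: "dim (X \<inter> Y) < dim X"
  proof (rule ccontr)
    assume "\<not> ?thesis"
    then have "X \<inter> Y = X" using I XY by (intro subspace_dim_equal) auto
    then have "X \<subseteq> Y" by blast
    then have "X = Y" using XY by (intro subspace_dim_equal) auto
    then show False using assms by simp
  qed
  have A: "{W. covers X W \<and> covers Y W} = (if Suc (dim (X \<inter> Y)) = dim X then {S} else {})"
  proof -
    have "W = S \<and> Suc (dim (X \<inter> Y)) = dim X" if "covers X W" "covers Y W" for W
    proof -
      have W: "subspace W" "X \<subseteq> W" "Y \<subseteq> W" "dim W = Suc (dim X)" using that by (auto simp: covers_def)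
      have "dim S \<le> dim W" using Smin[OF W(1-3)] by (rule dim_subset)
      then have "dim S = dim W" "Suc (dim (X \<inter> Y)) = dim X" using W(4) sum lt by linarith+
      then show ?thesis using subspace_dim_equal[OF S W(1) Smin[OF W(1-3)]] by simp
    qed
    moreover have "covers X S \<and> covers Y S" if "Suc (dim (X \<inter> Y)) = dim X"
      using that sum S XS YS XY by (simp add: covers_def)
    ultimately show ?thesis by auto
  qed
  have B: "{Z. covers Z X \<and> covers Z Y} = (if Suc (dim (X \<inter> Y)) = dim X then {X \<inter> Y} else {})"
  proof -
    have "Z = X \<inter> Y \<and> Suc (dim (X \<inter> Y)) = dim X" if "covers Z X" "covers Z Y" for Z
    proof -
      have Z: "subspace Z" "Z \<subseteq> X \<inter> Y" "dim X = Suc (dim Z)" using that by (auto simp: covers_def)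
      have "dim Z \<le> dim (X \<inter> Y)" using Z(2) by (rule dim_subset)
      then have "dim Z = dim (X \<inter> Y)" using Z(3) lt by linarith
      then show ?thesis using subspace_dim_equal[OF Z(1) I Z(2)] Z(3) by simp
    qed
    moreover have "covers (X \<inter> Y) X \<and> covers (X \<inter> Y) Y" if "Suc (dim (X \<inter> Y)) = dim X"
      using that I XY by (simp add: covers_def)
    ultimately show ?thesis by auto
  qed
  show ?thesis unfolding A B by simp
qed

lemma card_covers: "subspace X \<Longrightarrow> real (card {W. covers X W}) = qint Q (N - dim X)"
  using card_covers_between[of X UNIV] by (simp add: dimension_def)

lemma card_covered: "subspace X \<Longrightarrow> real (card {Z. covers Z X}) = qint Q (dim X)"
proof -
  assume X: "subspace X"
  have "{Z. covers Z X} = {Z. covers Z X \<and> {0} \<subseteq> Z}" by (auto simp: covers_def subspace_0)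
  then show ?thesis using card_covered_between[of "{0}" X] X by (simp add: subspace_0)
qed

text \<open>As kernels, the two compositions agree off the diagonal by
  \<open>card_common_covers\<close>; on the diagonal they count the upper and the lower covers of
  \<open>X\<close>.\<close>

lemma down_up:
  assumes "subspace X"
  shows "down (up f) X = up (down f) X + (qint Q (N - dim X) - qint Q (dim X)) * f X"
proof -
  have 1: "down (up f) X = (\<Sum>Y\<in>UNIV. real (card {W. covers X W \<and> covers Y W}) * f Y)"
    unfolding down_def up_def
    using sum_card_swap[of "{W. covers X W}" UNIV f "\<lambda>W Y. covers Y W"] by simp
  have 2: "up (down f) X = (\<Sum>Y\<in>UNIV. real (card {Z. covers Z X \<and> covers Z Y}) * f Y)"
    unfolding down_def up_def
    using sum_card_swap[of "{Z. covers Z X}" UNIV f "\<lambda>Z Y. covers Z Y"] by simp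
  have "down (up f) X - up (down f) X
    = (\<Sum>Y\<in>UNIV. (if Y = X then (qint Q (N - dim X) - qint Q (dim X)) * f X else 0))"
    unfolding 1 2 sum_subtractf[symmetric]
  proof (rule sum.cong)
    fix Y
    show "real (card {W. covers X W \<and> covers Y W}) * f Y - real (card {Z. covers Z X \<and> covers Z Y}) * f Y
      = (if Y = X then (qint Q (N - dim X) - qint Q (dim X)) * f X else 0)"
    proof (cases "Y = X")
      case True
      then show ?thesis using card_covers[OF assms] card_covered[OF assms] by (simp add: algebra_simps)
    next
      case False
      then show ?thesis using card_common_covers[of X Y] by simp
    qed
  qed simp
  then show ?thesis by simp
qed

text \<open>Every \<open>Z\<close> is reached along \<open>qint_fact Q h\<close> chains; in the
  induction the last link is counted by \<open>card_covered_between\<close>.\<close>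

lemma up_iter:
  assumes "subspace X"
  shows "(up ^^ h) f X = qint_fact Q h * (\<Sum>Z | subspace Z \<and> Z \<subseteq> X \<and> dim X = dim Z + h. f Z)"
  using assms
proof (induction h arbitrary: X)
  case 0
  have "Z = X" if "subspace Z" "Z \<subseteq> X" "dim X = dim Z" for Z
    using that 0 by (intro subspace_dim_equal) simp_all
  then have "{Z. subspace Z \<and> Z \<subseteq> X \<and> dim X = dim Z} = {X}"
    using 0 by blast
  then show ?case by (simp add: qint_fact_def)
next
  case (Suc h)
  let ?L = "{Z. subspace Z \<and> Z \<subseteq> X \<and> dim X = dim Z + Suc h}"
  have "(up ^^ Suc h) f X = (\<Sum>Y | covers Y X. (up ^^ h) f Y)"
    by (simp add: up_def)
  also have "\<dots> = (\<Sum>Y | covers Y X. qint_fact Q h * (\<Sum>Z | subspace Z \<and> Z \<subseteq> Y \<and> dim Y = dim Z + h. f Z))"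
    by (intro sum.cong refl Suc.IH) (simp add: covers_def)
  also have "\<dots> = qint_fact Q h * (\<Sum>Y | covers Y X. \<Sum>Z | subspace Z \<and> Z \<subseteq> Y \<and> dim Y = dim Z + h. f Z)"
    by (simp add: sum_distrib_left)
  also have "(\<Sum>Y | covers Y X. \<Sum>Z | subspace Z \<and> Z \<subseteq> Y \<and> dim Y = dim Z + h. f Z)
    = (\<Sum>Z\<in>?L. real (card {Y \<in> {Y. covers Y X}. Z \<subseteq> Y}) * f Z)"
    by (rule sum_swap_nested) (auto simp: covers_def)
  also have "\<dots> = (\<Sum>Z\<in>?L. qint Q (Suc h) * f Z)"
  proof (rule sum.cong)
    fix Z assume "Z \<in> ?L"
    then show "real (card {Y \<in> {Y. covers Y X}. Z \<subseteq> Y}) * f Z = qint Q (Suc h) * f Z"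
      using card_covered_between[of Z X] Suc.prems by simp
  qed simp
  finally show ?case by (simp add: qint_fact_def sum_distrib_left[symmetric])
qed

lemma down_iter:
  assumes "subspace X"
  shows "(down ^^ h) f X = qint_fact Q h * (\<Sum>Z | subspace Z \<and> X \<subseteq> Z \<and> dim Z = dim X + h. f Z)"
  using assms
proof (induction h arbitrary: X)
  case 0
  have "X = Z" if "subspace Z" "X \<subseteq> Z" "dim Z = dim X" for Z
    using that 0 by (intro subspace_dim_equal) simp_all
  then have "{Z. subspace Z \<and> X \<subseteq> Z \<and> dim Z = dim X} = {X}"
    using 0 by blast
  then show ?case by (simp add: qint_fact_def)
next
  case (Suc h)
  let ?L = "{Z. subspace Z \<and> X \<subseteq> Z \<and> dim Z = dim X + Suc h}"
  have "(down ^^ Suc h) f X = (\<Sum>Y | covers X Y. (down ^^ h) f Y)"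
    by (simp add: down_def)
  also have "\<dots> = (\<Sum>Y | covers X Y. qint_fact Q h * (\<Sum>Z | subspace Z \<and> Y \<subseteq> Z \<and> dim Z = dim Y + h. f Z))"
    by (intro sum.cong refl Suc.IH) (simp add: covers_def)
  also have "\<dots> = qint_fact Q h * (\<Sum>Y | covers X Y. \<Sum>Z | subspace Z \<and> Y \<subseteq> Z \<and> dim Z = dim Y + h. f Z)"
    by (simp add: sum_distrib_left)
  also have "(\<Sum>Y | covers X Y. \<Sum>Z | subspace Z \<and> Y \<subseteq> Z \<and> dim Z = dim Y + h. f Z)
    = (\<Sum>Z\<in>?L. real (card {Y \<in> {Y. covers X Y}. Y \<subseteq> Z}) * f Z)"
    by (rule sum_swap_nested) (auto simp: covers_def)
  also have "\<dots> = (\<Sum>Z\<in>?L. qint Q (Suc h) * f Z)"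
  proof (rule sum.cong)
    fix Z assume "Z \<in> ?L"
    then show "real (card {Y \<in> {Y. covers X Y}. Y \<subseteq> Z}) * f Z = qint Q (Suc h) * f Z"
      using card_covers_between[of X Z] Suc.prems by simp
  qed simp
  finally show ?case by (simp add: qint_fact_def sum_distrib_left[symmetric])
qed

section \<open>The adjacency operator as a combination of up and down\<close>

abbreviation level :: "nat \<Rightarrow> 'v set set" where
  "level k \<equiv> {U. subspace U \<and> dim U = k}"

definition supported :: "nat \<Rightarrow> ('v set \<Rightarrow> real) \<Rightarrow> bool" where
  "supported k f \<longleftrightarrow> (\<forall>X. f X \<noteq> 0 \<longrightarrow> X \<in> level k)"

lemma supported_up: "supported k f \<Longrightarrow> supported (Suc k) (up f)"
  unfolding supported_def up_def
  by (metis (mono_tags, lifting) covers_def mem_Collect_eq sum.neutral)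

lemma supported_up_iter: "supported k f \<Longrightarrow> supported (k + h) ((up ^^ h) f)"
  by (induction h) (auto intro: supported_up)

text \<open>Stated additively, so that it also shows that more than \<open>k\<close> applications of
  \<open>down\<close> give the zero function.\<close>

lemma supported_down_iter: "supported k f \<Longrightarrow> (down ^^ h) f X \<noteq> 0 \<Longrightarrow> subspace X \<and> dim X + h = k"
proof (induction h arbitrary: X)
  case 0
  then show ?case by (auto simp: supported_def)
next
  case (Suc h)
  then obtain Y where "covers X Y" "(down ^^ h) f Y \<noteq> 0"
    unfolding funpow.simps comp_def down_def by (metis (mono_tags, lifting) mem_Collect_eq sum.neutral)
  then show ?case using Suc.IH[of Y] Suc.prems by (auto simp: covers_def)
qed

lemma sum_supported: "supported k f \<Longrightarrow> (\<Sum>X\<in>UNIV. f X * g X) = (\<Sum>X\<in>level k. f X * g X)"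
  by (rule sum.mono_neutral_right) (auto simp: supported_def)

text \<open>The entry at a pair \<open>X\<close>, \<open>Y\<close> counts the subspaces of dimension
  \<open>d - h\<close> contained in both, that is, in the intersection.\<close>

lemma up_down_iter:
  assumes X: "X \<in> level d" and "h \<le> d"
  shows "(up ^^ h) ((down ^^ h) f) X
    = qint_fact Q h ^ 2 * (\<Sum>Y\<in>level d. qbinom Q (dim (X \<inter> Y)) (d - h) * f Y)"
proof -
  let ?Z = "{Z. subspace Z \<and> Z \<subseteq> X \<and> dim X = dim Z + h}"
  have "(up ^^ h) ((down ^^ h) f) X = qint_fact Q h * (\<Sum>Z\<in>?Z. (down ^^ h) f Z)"
    using X by (simp add: up_iter)
  also have "(\<Sum>Z\<in>?Z. (down ^^ h) f Z) = (\<Sum>Z\<in>?Z. qint_fact Q h * (\<Sum>Y | subspace Y \<and> Z \<subseteq> Y \<and> dim Y = dim Z + h. f Y))"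
    by (rule sum.cong) (auto simp: down_iter)
  also have "\<dots> = qint_fact Q h * (\<Sum>Z\<in>?Z. \<Sum>Y | subspace Y \<and> Z \<subseteq> Y \<and> dim Y = dim Z + h. f Y)"
    by (simp add: sum_distrib_left)
  also have "(\<Sum>Z\<in>?Z. \<Sum>Y | subspace Y \<and> Z \<subseteq> Y \<and> dim Y = dim Z + h. f Y)
     = (\<Sum>Y\<in>level d. real (card {Z \<in> ?Z. Z \<subseteq> Y}) * f Y)"
    by (rule sum_swap_nested) (use X in auto)
  also have "\<dots> = (\<Sum>Y\<in>level d. qbinom Q (dim (X \<inter> Y)) (d - h) * f Y)"
  proof (rule sum.cong)
    fix Y assume Y: "Y \<in> level d"
    have "{Z \<in> ?Z. Z \<subseteq> Y} = {Z. subspace Z \<and> Z \<subseteq> X \<inter> Y \<and> dim Z = d - h}"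
      using X assms(2) by auto
    moreover have "subspace (X \<inter> Y)" using X Y by (intro subspace_inter) auto
    ultimately show "real (card {Z \<in> ?Z. Z \<subseteq> Y}) * f Y = qbinom Q (dim (X \<inter> Y)) (d - h) * f Y"
      by (simp only: card_subspaces_within)
  qed simp
  finally show ?thesis by (simp add: power2_eq_square)
qed

text \<open>\<open>up_down_iter\<close> turns the right side into entries
  \<open>qbinom Q (dim (X \<inter> Y)) (d - h)\<close>, and \<open>qbinom_inversion_shifted\<close>
  extracts from these the pairs whose intersection has dimension \<open>d - j\<close>.\<close>

lemma adjacency_sum:
  assumes X: "X \<in> level d" and j: "j \<le> d"
  shows "(\<Sum>Y | Y \<in> level d \<and> dim (X \<inter> Y) + j = d. f Y)
    = (\<Sum>h\<le>j. (-1) ^ (j - h) * Q ^ (j - h choose 2) * qbinom Q (d - h) (j - h)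
        * ((up ^^ h) ((down ^^ h) f) X / qint_fact Q h ^ 2))"
proof -
  let ?c = "\<lambda>h. (-1) ^ (j - h) * Q ^ (j - h choose 2) * qbinom Q (d - h) (j - h)"
  have "(\<Sum>h\<le>j. ?c h * ((up ^^ h) ((down ^^ h) f) X / qint_fact Q h ^ 2))
     = (\<Sum>h\<le>j. \<Sum>Y\<in>level d. ?c h * qbinom Q (dim (X \<inter> Y)) (d - h) * f Y)"
  proof (rule sum.cong)
    fix h assume "h \<in> {..j}"
    then have "h \<le> d" using j by simp
    have nz: "qint_fact Q h ^ 2 \<noteq> 0" using qint_fact_pos[OF Q_gt1, of h] by simp
    show "?c h * ((up ^^ h) ((down ^^ h) f) X / qint_fact Q h ^ 2)
      = (\<Sum>Y\<in>level d. ?c h * qbinom Q (dim (X \<inter> Y)) (d - h) * f Y)"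
      unfolding up_down_iter[OF X \<open>h \<le> d\<close>] nonzero_mult_div_cancel_left[OF nz] by (simp add: sum_distrib_left mult.assoc)
  qed simp
  also have "\<dots> = (\<Sum>Y\<in>level d. \<Sum>h\<le>j. ?c h * qbinom Q (dim (X \<inter> Y)) (d - h) * f Y)"
    by (rule sum.swap)
  also have "\<dots> = (\<Sum>Y\<in>level d. (if dim (X \<inter> Y) + j = d then f Y else 0))"
  proof (rule sum.cong)
    fix Y assume "Y \<in> level d"
    have "dim (X \<inter> Y) \<le> dim X" by (rule dim_subset) simp
    then have "(\<Sum>h\<le>j. ?c h * qbinom Q (dim (X \<inter> Y)) (d - h)) = (if dim (X \<inter> Y) + j = d then 1 else 0)"
      using X j by (intro qbinom_inversion_shifted[OF Q_gt1]) auto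
    then show "(\<Sum>h\<le>j. ?c h * qbinom Q (dim (X \<inter> Y)) (d - h) * f Y) = (if dim (X \<inter> Y) + j = d then f Y else 0)"
      by (simp flip: sum_distrib_right)
  qed simp
  also have "\<dots> = (\<Sum>Y | Y \<in> level d \<and> dim (X \<inter> Y) + j = d. f Y)"
    by (simp add: sum.If_cases Int_def)
  finally show ?thesis ..
qed

section \<open>Harmonic functions and the eigenvalues they produce\<close>

definition harmonic :: "nat \<Rightarrow> ('v set \<Rightarrow> real) \<Rightarrow> bool" where
  "harmonic i g \<longleftrightarrow> supported i g \<and> down g = (\<lambda>_. 0)"

text \<open>There are more unknowns than equations: \<open>2 * i <= N\<close> makes the
  \<open>i\<close>-dimensional subspaces strictly more numerous than those of dimension
  \<open>i - 1\<close>.\<close>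

lemma harmonic_exists:
  assumes "2 * i \<le> N"
  shows "\<exists>g. harmonic i g \<and> (\<exists>X. g X \<noteq> 0)"
proof -
  \<comment> \<open>Written with \<open>Suc\<close>, so that for \<open>i = 0\<close> there are no
    equations at all.\<close>
  let ?A = "{X. subspace X \<and> Suc (dim X) = i}"
  have lev: "real (card (level k)) = qbinom Q N k" for k
    using card_subspaces_within[of UNIV k] by (simp add: dimension_def)
  have "card ?A < card (level i)"
  proof (cases i)
    case 0
    have "real (card (level 0)) > 0" unfolding lev by simp
    then show ?thesis using 0 by simp
  next
    case (Suc k)
    have pos: "qbinom Q N k > 0" using assms Suc by (intro qbinom_pos Q_gt1) simp
    have "Q ^ Suc k < Q ^ (N - k)" using Q_gt1 assms Suc by (intro power_strict_increasing) auto
    then have "(Q ^ Suc k - 1) * qbinom Q N k < (Q ^ (N - k) - 1) * qbinom Q N k"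
      using pos by simp
    then have "(Q ^ Suc k - 1) * qbinom Q N k < (Q ^ Suc k - 1) * qbinom Q N (Suc k)"
      by (simp only: qbinom_Suc_right[OF Q_gt1])
    then have "qbinom Q N k < qbinom Q N (Suc k)"
      using power_Suc_gt1[OF Q_gt1, of k] by (simp add: mult_less_cancel_left_pos del: power_Suc)
    then have "real (card (level k)) < real (card (level i))" unfolding lev Suc .
    moreover have "?A = level k" using Suc by auto
    ultimately show ?thesis by simp
  qed
  from nonzero_kernel[OF finite_vector_sets finite_vector_sets this, of "\<lambda>X Y. if covers X Y then 1 else 0"]
  obtain f :: "'v set \<Rightarrow> real" where f: "\<exists>Y\<in>level i. f Y \<noteq> 0"
    "\<forall>X\<in>?A. (\<Sum>Y\<in>level i. (if covers X Y then 1 else 0) * f Y) = 0"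
    by blast
  define g where "g X = (if X \<in> level i then f X else 0)" for X
  have "down g X = 0" for X
  proof (cases "X \<in> ?A")
    case True
    have "down g X = (\<Sum>Y\<in>level i. (if covers X Y then 1 else 0) * f Y)"
      unfolding down_def g_def
      by (rule sum.mono_neutral_cong_left) (use True in \<open>auto simp: covers_def\<close>)
    then show ?thesis using f(2) True by simp
  next
    case False
    then show ?thesis unfolding down_def g_def by (intro sum.neutral) (auto simp: covers_def)
  qed
  then have "harmonic i g" by (auto simp: harmonic_def supported_def g_def)
  moreover have "\<exists>X. g X \<noteq> 0" using f(1) by (auto simp: g_def)
  ultimately show ?thesis by blast
qed

lemma down_up_iter_harmonic:
  assumes g: "harmonic i g" and "2 * i + k \<le> N"
  shows "down ((up ^^ Suc k) g) = (\<lambda>X. Q ^ i * qint Q (Suc k) * qint Q (N - 2 * i - k) * (up ^^ k) g X)"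
  using assms(2)
proof (induction k)
  case 0
  show ?case
  proof
    fix X
    have "down (up g) X = (qint Q (N - i) - qint Q i) * g X"
    proof (cases "X \<in> level i")
      case True
      then show ?thesis using g by (simp add: down_up harmonic_def up_def)
    next
      case False
      then have "g X = 0" using g by (auto simp: harmonic_def supported_def)
      moreover have "down (up g) X = 0"
        using supported_up_iter[of i g 1] g False
        by (cases "subspace X") (auto simp: down_up harmonic_def up_def \<open>g X = 0\<close>, auto simp: down_def covers_def)
      ultimately show ?thesis by simp
    qed
    then show "down ((up ^^ Suc 0) g) X = Q ^ i * qint Q (Suc 0) * qint Q (N - 2 * i - 0) * (up ^^ 0) g X"
      using qint_step[OF Q_gt1, of i 0 N] 0 by simp
  qed
next
  case (Suc k)
  let ?u = "(up ^^ Suc k) g"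
  have IH: "down ?u = (\<lambda>X. Q ^ i * qint Q (Suc k) * qint Q (N - 2 * i - k) * (up ^^ k) g X)"
    using Suc by simp
  have ud: "up (down ?u) = (\<lambda>X. Q ^ i * qint Q (Suc k) * qint Q (N - 2 * i - k) * ?u X)"
    unfolding IH up_scale by simp
  have supp: "supported (i + Suc k) ?u"
    using supported_up_iter[of i g "Suc k"] g by (simp add: harmonic_def)
  show ?case
  proof
    fix X
    let ?c = "qint Q (N - i - Suc k) - qint Q (i + Suc k)"
    \<comment> \<open>The scalar of \<open>down_up\<close> depends on \<open>dim X\<close>; wherever
      the dimension is not \<open>i + Suc k\<close>, the function \<open>?u\<close> vanishes and the
      scalar does not matter.\<close>
    have "down (up ?u) X = up (down ?u) X + ?c * ?u X"
    proof (cases "subspace X")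
      case True
      show ?thesis
      proof (cases "?u X = 0")
        case True
        then show ?thesis using down_up[OF \<open>subspace X\<close>, of ?u] by (simp del: funpow.simps)
      next
        case False
        then have "dim X = i + Suc k" using supp unfolding supported_def by blast
        then show ?thesis using down_up[OF True, of ?u] by (simp add: diff_diff_left del: funpow.simps)
      qed
    next
      case False
      then have "?u X = 0" using supp unfolding supported_def by blast
      moreover have "down (up ?u) X = 0" "up (down ?u) X = 0"
        using False by (simp_all add: down_def[of _ X] up_def[of _ X] covers_def)
      ultimately show ?thesis by simp
    qed
    also have "\<dots> = (Q ^ i * qint Q (Suc k) * qint Q (N - 2 * i - k) + ?c) * ?u X"
      unfolding ud by (simp add: distrib_right del: funpow.simps)
    also have "Q ^ i * qint Q (Suc k) * qint Q (N - 2 * i - k) + ?c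
       = Q ^ i * qint Q (Suc (Suc k)) * qint Q (N - 2 * i - Suc k)"
    proof -
      have "N - 2 * i - k = N - 2 * i - Suc k + 1" using Suc.prems by simp
      then show ?thesis using qint_step[OF Q_gt1 Suc.prems] by simp
    qed
    finally show "down ((up ^^ Suc (Suc k)) g) X
       = Q ^ i * qint Q (Suc (Suc k)) * qint Q (N - 2 * i - Suc k) * (up ^^ Suc k) g X"
      by simp
  qed
qed

text \<open>Repeated use of \<open>down_up_iter_harmonic\<close>; the highest index needed is
  \<open>k + h - 1\<close>, hence the bound \<open>Suc N\<close>.\<close>

lemma down_iter_up_iter_harmonic:
  assumes g: "harmonic i g" and "2 * i + k + h \<le> Suc N"
  shows "(down ^^ h) ((up ^^ (k + h)) g)
    = (\<lambda>X. (\<Prod>l<h. Q ^ i * qint Q (Suc (k + l)) * qint Q (N - 2 * i - (k + l))) * (up ^^ k) g X)"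
  using assms(2)
proof (induction h)
  case (Suc h)
  have "(down ^^ Suc h) ((up ^^ (k + Suc h)) g) = (down ^^ h) (down ((up ^^ Suc (k + h)) g))"
    by (simp add: funpow_swap1)
  also have "\<dots> = (\<lambda>X. Q ^ i * qint Q (Suc (k + h)) * qint Q (N - 2 * i - (k + h)) * (down ^^ h) ((up ^^ (k + h)) g) X)"
    by (subst down_up_iter_harmonic[OF g]) (use Suc.prems in simp, rule down_iter_scale)
  also have "(down ^^ h) ((up ^^ (k + h)) g)
    = (\<lambda>X. (\<Prod>l<h. Q ^ i * qint Q (Suc (k + l)) * qint Q (N - 2 * i - (k + l))) * (up ^^ k) g X)"
    using Suc by simp
  finally show ?case by (simp add: mult_ac)
qed simp

text \<open>For \<open>h <= d - i\<close> the product of scalars splits into two runs of consecutive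
  \<open>q\<close>-integers, each a Gaussian coefficient times \<open>qint_fact Q h\<close>. These
  two coefficients are the ones in \<open>grassmann_G\<close>.\<close>

lemma up_down_iter_harmonic:
  assumes g: "harmonic i g" and "i \<le> d" "2 * d \<le> N"
  shows "(up ^^ h) ((down ^^ h) ((up ^^ (d - i)) g))
     = (\<lambda>X. Q ^ (h * i) * qbinom Q (d - i) h * qbinom Q (N - d - i + h) h * qint_fact Q h ^ 2 * (up ^^ (d - i)) g X)"
proof (cases "h \<le> d - i")
  case True
  define k where "k = d - i - h"
  have k: "d - i = k + h" using True by (simp add: k_def)
  have "(up ^^ h) ((down ^^ h) ((up ^^ (k + h)) g))
     = (\<lambda>X. (\<Prod>l<h. Q ^ i * qint Q (Suc (k + l)) * qint Q (N - 2 * i - (k + l))) * (up ^^ h) ((up ^^ k) g) X)"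
    using assms k by (subst down_iter_up_iter_harmonic[OF g]) (simp_all add: up_iter_scale)
  also have "(up ^^ h) ((up ^^ k) g) = (up ^^ (k + h)) g"
    by (simp add: add.commute[of k] funpow_add)
  also have "(\<Prod>l<h. Q ^ i * qint Q (Suc (k + l)) * qint Q (N - 2 * i - (k + l)))
     = Q ^ (h * i) * (\<Prod>l<h. qint Q (Suc (k + l))) * (\<Prod>l<h. qint Q (N - 2 * i - (k + l)))"
    by (simp add: prod.distrib power_mult[symmetric] mult.commute)
  also have "(\<Prod>l<h. qint Q (Suc (k + l))) = qbinom Q (k + h) h * qint_fact Q h"
  proof -
    have "(\<Prod>l<h. qint Q (Suc (k + l))) = (\<Prod>l<h. qint Q (Suc (k + (h - Suc l))))"
      by (rule prod.nat_diff_reindex[symmetric])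
    also have "\<dots> = (\<Prod>l<h. qint Q (k + h - l))"
      by (rule prod.cong) (auto intro!: arg_cong[where f = "qint Q"])
    finally show ?thesis by (simp add: prod_qint[OF Q_gt1])
  qed
  also have "(\<Prod>l<h. qint Q (N - 2 * i - (k + l))) = qbinom Q (N - d - i + h) h * qint_fact Q h"
  proof -
    have "(\<Prod>l<h. qint Q (N - 2 * i - (k + l))) = (\<Prod>l<h. qint Q (N - d - i + h - l))"
      using assms k by (intro prod.cong) (auto intro!: arg_cong[where f = "qint Q"])
    then show ?thesis by (simp add: prod_qint[OF Q_gt1])
  qed
  finally show ?thesis unfolding k by (simp add: power2_eq_square mult_ac)
next
  case False
  \<comment> \<open>After \<open>d - i\<close> applications of \<open>down\<close> a multiple of
    \<open>g\<close> is left, and one more gives zero, in agreement with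
    \<open>qbinom Q (d - i) h = 0\<close>.\<close>
  then obtain m where h: "h = m + Suc (d - i)" by (metis add.commute less_iff_Suc_add not_le add_Suc_right)
  have "(down ^^ (d - i)) ((up ^^ (0 + (d - i))) g)
     = (\<lambda>X. (\<Prod>l<d - i. Q ^ i * qint Q (Suc (0 + l)) * qint Q (N - 2 * i - (0 + l))) * (up ^^ 0) g X)"
    using assms by (intro down_iter_up_iter_harmonic) auto
  then have "down ((down ^^ (d - i)) ((up ^^ (d - i)) g)) = (\<lambda>X. 0)"
    using g by (simp add: down_scale harmonic_def)
  then have "(down ^^ h) ((up ^^ (d - i)) g) = (down ^^ m) (\<lambda>X. 0)"
    by (simp only: h funpow_add comp_apply funpow.simps)
  also have "\<dots> = (\<lambda>X. 0)" using down_iter_scale[of m 0 "\<lambda>X. 0"] by simp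
  finally have "(up ^^ h) ((down ^^ h) ((up ^^ (d - i)) g)) = (up ^^ h) (\<lambda>X. 0)" by simp
  also have "\<dots> = (\<lambda>X. 0)" using up_iter_scale[of h 0 "\<lambda>X. 0"] by simp
  finally show ?thesis using False by (simp add: qbinom_eq_0)
qed

lemma adjacency_sum_harmonic:
  assumes g: "harmonic i g" and "i \<le> d" "2 * d \<le> N" "j \<le> d" and X: "X \<in> level d"
  shows "(\<Sum>Y | Y \<in> level d \<and> dim (X \<inter> Y) + j = d. (up ^^ (d - i)) g Y)
     = grassmann_G (CARD('k)) N d j i * (up ^^ (d - i)) g X"
proof -
  have G: "grassmann_G (CARD('k)) N d j i = grassmann_sum Q i (d - i) (N - d - i) j"
    using assms card_scalars by (simp add: grassmann_G_eq_sum Q_card)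
  show ?thesis
    unfolding adjacency_sum[OF X assms(4)] up_down_iter_harmonic[OF assms(1-3)] G grassmann_sum_def
      sum_distrib_right
  proof (rule sum.cong)
    fix h
    have "qint_fact Q h \<noteq> 0" using qint_fact_pos[OF Q_gt1, of h] by simp
    moreover have "d - i + i - h = d - h" using assms(2) by simp
    ultimately show "(-1) ^ (j - h) * Q ^ (j - h choose 2) * qbinom Q (d - h) (j - h) *
        (Q ^ (h * i) * qbinom Q (d - i) h * qbinom Q (N - d - i + h) h * (qint_fact Q h)\<^sup>2 *
          (up ^^ (d - i)) g X / (qint_fact Q h)\<^sup>2) =
      (-1) ^ (j - h) * Q ^ (h * i + (j - h choose 2)) * qbinom Q (d - i) h *
        qbinom Q (d - i + i - h) (j - h) * qbinom Q (N - d - i + h) h * (up ^^ (d - i)) g X"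
      by (simp add: power_add)
  qed simp
qed

text \<open>Lowering back returns a multiple of \<open>g\<close>, and \<open>2 * d <= N\<close>
  keeps all \<open>q\<close>-integers in the scalar positive.\<close>

lemma up_iter_harmonic_nonzero:
  assumes g: "harmonic i g" "g X \<noteq> 0" and "i \<le> d" "2 * d \<le> N"
  shows "\<exists>Y\<in>level d. (up ^^ (d - i)) g Y \<noteq> 0"
proof -
  let ?p = "\<Prod>l<d - i. Q ^ i * qint Q (Suc (0 + l)) * qint Q (N - 2 * i - (0 + l))"
  have "(down ^^ (d - i)) ((up ^^ (0 + (d - i))) g) = (\<lambda>X. ?p * (up ^^ 0) g X)"
    using assms by (intro down_iter_up_iter_harmonic) auto
  moreover have "?p > 0"
    using assms Q_gt1 by (intro prod_pos mult_pos_pos qint_pos) auto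
  ultimately have "(down ^^ (d - i)) ((up ^^ (d - i)) g) X \<noteq> 0"
    using g(2) by (simp del: prod_zero_iff)
  then have "(up ^^ (d - i)) g \<noteq> (\<lambda>_. 0)"
    using down_iter_scale[of "d - i" 0 "\<lambda>_. 0"] by auto
  then obtain Y where "(up ^^ (d - i)) g Y \<noteq> 0" by auto
  moreover have "supported d ((up ^^ (d - i)) g)"
    using supported_up_iter[of i g "d - i"] g(1) assms(3) by (simp add: harmonic_def)
  ultimately show ?thesis by (auto simp: supported_def)
qed

text \<open>The adjacency operator is symmetric, and \<open>f\<close> and \<open>F\<close> are
  eigenvectors with nonzero inner product, so their eigenvalues coincide.\<close>

lemma adjacency_eigenvalue:
  assumes "2 * d \<le> N" "j \<le> d"
    and f: "supported d f" "f X0 \<noteq> 0"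
    and eig: "\<And>X. X \<in> level d \<Longrightarrow> (\<Sum>Y | Y \<in> level d \<and> dim (X \<inter> Y) + j = d. f Y) = \<theta> * f X"
  shows "\<exists>i\<le>d. \<theta> = grassmann_G (CARD('k)) N d j i"
proof -
  \<comment> \<open>The minimum exists because \<open>down\<close> applied \<open>Suc d\<close>
    times to \<open>f\<close> is zero. It is positive since \<open>f\<close> is nonzero, so
    \<open>h = m - 1\<close> indexes the last nonzero iterate.\<close>
  define m where "m = (LEAST h. (down ^^ h) f = (\<lambda>_. 0))"
  have ex: "(down ^^ Suc d) f = (\<lambda>_. 0)"
    using supported_down_iter[OF f(1), of "Suc d"] by fastforce
  have m0: "(down ^^ m) f = (\<lambda>_. 0)" unfolding m_def by (rule LeastI[of _ "Suc d"]) (rule ex)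
  have "m \<noteq> 0"
  proof
    assume "m = 0"
    then have "f = (\<lambda>_. 0)" using m0 by simp
    then show False using f(2) by simp
  qed
  then obtain h where h: "m = Suc h" by (cases m) auto
  have nz: "(down ^^ h) f \<noteq> (\<lambda>_. 0)"
    using not_less_Least[of h "\<lambda>h. (down ^^ h) f = (\<lambda>_. 0)"] h unfolding m_def by simp
  define g where "g = (down ^^ h) f"
  obtain Z where Z: "g Z \<noteq> 0" using nz by (auto simp: g_def)
  then have hd: "h \<le> d" using supported_down_iter[OF f(1), of h Z] by (simp add: g_def)
  define i where "i = d - h"
  have i: "i \<le> d" "d - i = h" using hd by (auto simp: i_def)
  have "supported i g"
    unfolding supported_def
  proof (intro allI impI)
    fix X assume "g X \<noteq> 0"
    then have "subspace X \<and> dim X + h = d"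
      using supported_down_iter[OF f(1), of h X] by (simp add: g_def)
    then show "X \<in> level i" by (auto simp: i_def)
  qed
  moreover have "down g = (\<lambda>_. 0)" using m0 h by (simp add: g_def)
  ultimately have g: "harmonic i g" by (simp add: harmonic_def)
  define F where "F = (up ^^ h) g"
  have F: "(\<Sum>Y | Y \<in> level d \<and> dim (X \<inter> Y) + j = d. F Y) = grassmann_G (CARD('k)) N d j i * F X"
    if "X \<in> level d" for X
    using adjacency_sum_harmonic[OF g i(1) assms(1,2) that] i(2) by (simp add: F_def)
  have "(\<Sum>X\<in>UNIV. f X * F X) = (\<Sum>X\<in>UNIV. g X * g X)"
    unfolding F_def up_down_iter_adjoint by (simp add: g_def)
  also have "\<dots> > 0"
    using Z by (intro sum_pos2[of UNIV Z]) (auto simp: zero_less_mult_iff linorder_neq_iff)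
  finally have pos: "(\<Sum>X\<in>level d. f X * F X) > 0"
    using sum_supported[OF f(1)] by simp
  have "\<theta> * (\<Sum>X\<in>level d. f X * F X) = (\<Sum>X\<in>level d. \<Sum>Y | Y \<in> level d \<and> dim (X \<inter> Y) + j = d. f Y * F X)"
    unfolding sum_distrib_left
    by (rule sum.cong) (auto simp: mult.assoc[symmetric] sum_distrib_right[symmetric] eig[symmetric])
  \<comment> \<open>Symmetry of adjacency: exchanging the two summations moves the operator from
    \<open>f\<close> to \<open>F\<close>.\<close>
  also have "\<dots> = (\<Sum>Y\<in>level d. \<Sum>X | X \<in> level d \<and> dim (X \<inter> Y) + j = d. f Y * F X)"
    by (rule sum.swap_restrict) auto
  also have "\<dots> = (\<Sum>Y\<in>level d. f Y * (\<Sum>X | X \<in> level d \<and> dim (Y \<inter> X) + j = d. F X))"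
    by (simp add: sum_distrib_left Int_commute)
  also have "\<dots> = (\<Sum>Y\<in>level d. grassmann_G (CARD('k)) N d j i * (f Y * F Y))"
  proof (rule sum.cong)
    fix Y assume Y: "Y \<in> level d"
    show "f Y * (\<Sum>X | X \<in> level d \<and> dim (Y \<inter> X) + j = d. F X) = grassmann_G (CARD('k)) N d j i * (f Y * F Y)"
      unfolding F[OF Y] by simp
  qed simp
  also have "\<dots> = grassmann_G (CARD('k)) N d j i * (\<Sum>X\<in>level d. f X * F X)"
    by (simp add: sum_distrib_left)
  finally show ?thesis using pos i(1) by auto
qed

lemma graph_eigenvalue_grassmann:
  assumes "2 * d \<le> N" "j \<le> d"
  shows "graph_eigenvalue (grassmann_vertices scale d) (grassmann_adj scale d j) \<theta>
    \<longleftrightarrow> (\<exists>i\<le>d. \<theta> = grassmann_G (CARD('k)) N d j i)"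
proof -
  have V: "grassmann_vertices scale d = level d" by (simp add: grassmann_vertices_def)
  have adj: "grassmann_adj scale d j X Y \<longleftrightarrow> dim (X \<inter> Y) + j = d" for X Y
    unfolding grassmann_adj_def by linarith
  have fin: "finite (level d)" by simp
  show ?thesis
    unfolding V graph_eigenvalue_iff[OF fin] adj
  proof
    assume "\<exists>f. (\<exists>X\<in>level d. f X \<noteq> 0) \<and>
      (\<forall>X\<in>level d. (\<Sum>Y | Y \<in> level d \<and> dim (X \<inter> Y) + j = d. f Y) = \<theta> * f X)"
    then obtain f X0 where f: "X0 \<in> level d" "f X0 \<noteq> 0"
      "\<And>X. X \<in> level d \<Longrightarrow> (\<Sum>Y | Y \<in> level d \<and> dim (X \<inter> Y) + j = d. f Y) = \<theta> * f X" by blast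
    \<comment> \<open>Values of \<open>f\<close> off level \<open>d\<close> are arbitrary; extension
      by zero makes the iterates of \<open>down\<close> depend on the vertices alone.\<close>
    define f' where "f' X = (if X \<in> level d then f X else 0)" for X
    have "supported d f'" "f' X0 \<noteq> 0" using f by (auto simp: f'_def supported_def)
    then show "\<exists>i\<le>d. \<theta> = grassmann_G (CARD('k)) N d j i"
    proof (rule adjacency_eigenvalue[OF assms])
      fix X assume X: "X \<in> level d"
      have "(\<Sum>Y | Y \<in> level d \<and> dim (X \<inter> Y) + j = d. f' Y) = (\<Sum>Y | Y \<in> level d \<and> dim (X \<inter> Y) + j = d. f Y)"
        by (rule sum.cong) (auto simp: f'_def)
      then show "(\<Sum>Y | Y \<in> level d \<and> dim (X \<inter> Y) + j = d. f' Y) = \<theta> * f' X"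
        using f(3)[OF X] X by (simp add: f'_def)
    qed
  next
    assume "\<exists>i\<le>d. \<theta> = grassmann_G (CARD('k)) N d j i"
    then obtain i where i: "i \<le> d" "\<theta> = grassmann_G (CARD('k)) N d j i" by blast
    obtain g X where g: "harmonic i g" "g X \<noteq> 0" using harmonic_exists[of i] i assms by auto
    show "\<exists>f. (\<exists>X\<in>level d. f X \<noteq> 0) \<and>
      (\<forall>X\<in>level d. (\<Sum>Y | Y \<in> level d \<and> dim (X \<inter> Y) + j = d. f Y) = \<theta> * f X)"
      using up_iter_harmonic_nonzero[OF g i(1) assms(1)] adjacency_sum_harmonic[OF g(1) i(1) assms] i(2)
      by (intro exI[of _ "(up ^^ (d - i)) g"]) auto
  qed
qed

end

section \<open>The smallest eigenvalue of the graph\<close>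

theorem theorem5p8:
  fixes scale :: "'k::{field,finite} \<Rightarrow> 'v::ab_group_add \<Rightarrow> 'v"
    and q n d j :: nat
  assumes "primepow q" and "CARD('k) = q"
    and "vector_space scale" and "vector_space.dim scale (UNIV :: 'v set) = n"
    and "n \<ge> 2 * d" and "1 \<le> j" and "j \<le> d"
  shows "(q \<ge> 3 \<or> (q = 2 \<and> n \<ge> 2 * d + 1) \<longrightarrow>
            smallest_graph_eigenvalue (grassmann_vertices scale d) (grassmann_adj scale d j)
              (grassmann_G q n d j (d - j + 1)))
       \<and> ((n, q) = (2 * d, 2) \<and> 7 \<le> j \<and> j + 5 \<le> d \<longrightarrow>
            smallest_graph_eigenvalue (grassmann_vertices scale d) (grassmann_adj scale d j)
              (grassmann_G q n d j (d - j)))"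
proof -
  interpret vector_space scale by fact
  obtain B where B: "independent B" "UNIV \<subseteq> span B" "card B = dim UNIV"
    using basis_exists[of UNIV] by metis
  have "card B = n" using B(3) assms(4) by simp
  \<comment> \<open>An infinite basis would have \<open>card\<close> 0, but
    \<open>n >= 2 * d >= 2\<close>; so the dimension hypothesis forces a finite-dimensional
    space.\<close>
  then have "finite B" using assms(5-7) by (intro card_ge_0_finite) linarith
  then interpret finite_field_space scale B "real q"
    using B assms(2) by unfold_locales auto
  have N: "N = n" using \<open>card B = n\<close> by (simp add: dimension_def)
  have ev: "graph_eigenvalue (grassmann_vertices scale d) (grassmann_adj scale d j) \<theta>
      \<longleftrightarrow> (\<exists>i\<le>d. \<theta> = grassmann_G q n d j i)" for \<theta>
    using graph_eigenvalue_grassmann[of d j \<theta>] assms(2,5,7) N by simp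
  show ?thesis
    unfolding smallest_graph_eigenvalue_def ev
  proof (intro conjI impI allI)
    show "\<exists>i\<le>d. grassmann_G q n d j (d - j + 1) = grassmann_G q n d j i"
      using assms(6,7) by (intro exI[of _ "d - j + 1"]) simp
    show "\<exists>i\<le>d. grassmann_G q n d j (d - j) = grassmann_G q n d j i"
      by (intro exI[of _ "d - j"]) simp
  next
    fix \<theta> assume "q \<ge> 3 \<or> q = 2 \<and> n \<ge> 2 * d + 1" "\<exists>i\<le>d. \<theta> = grassmann_G q n d j i"
    then show "grassmann_G q n d j (d - j + 1) \<le> \<theta>"
      using grassmann_G_min_generic assms(5-7) by blast
  next
    fix \<theta> assume "(n, q) = (2 * d, 2) \<and> 7 \<le> j \<and> j + 5 \<le> d" "\<exists>i\<le>d. \<theta> = grassmann_G q n d j i"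
    then show "grassmann_G q n d j (d - j) \<le> \<theta>"
      using grassmann_G_min_binary by blast
  qed
qed

end
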